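(* Let $(K,\mathcal{K})$ be a directed Euclidean cubical complex in $\mathbb{R}^n$ that has a minimum vertex $w$. Let $\tau,\sigma\in\mathcal{K}$ be such that $\tau$ is a free face of $\sigma$, and let $(K',\mathcal{K}')$ be the $(\tau,\sigma)$-collapse of $K$. If $K'$ is an LPDC of $K$, then the spaces of dipaths $\overrightarrow{P}_{w}^{v}(K)$ are contractible for all $v\in\mathrm{verts}(K)$ if and only if the spaces of dipaths $\overrightarrow{P}_{w}^{k}(K')$ are contractible for all $k\in\mathrm{verts}(K')$.
   Context: Order: for $p,q\in\mathbb{R}^n$, $p\preceq q$ means $p_i\le q_i$ for every $i$, and $[p,q]:=\{x\in\mathbb{R}^n : p\preceq x\preceq q\}$. Cubes: an elementary cube in $\mathbb{R}^n$ is a set $[v-j,v]$ with $v\in\mathbb{Z}^n$, $j\in\{0,1\}^n$; its dimension is $\sum_i j_i$. If $\tau\subseteq\sigma$ are elementary cubes, $\tau$ is a face of $\sigma$ and $\sigma$ is a coface of $\tau$. Complexes: a (directed) Euclidean cubical complex $(K,\mathcal{K})$ in $\mathbb{R}^n$ is a subspace $K\subsetneq\mathbb{R}^n$ that is a finite union of elementary cubes, together with the stratification $\mathcal{K}$ of $K$ whose strata are the relative interiors of the elementary cubes contained in $K$ (a vertex being its own relative interior). For $\sigma\in\mathcal{K}$, $\overline{\sigma}$ is the corresponding closed elementary cube; faces of $\sigma$ refer to $\overline{\sigma}$. $\mathrm{verts}(K)=K\cap\mathbb{Z}^n$ is the set of zero-cubes of $K$. A cube of $K$ is maximal if it has no proper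 coface in $K$. A minimum vertex of $K$ is $w\in\mathrm{verts}(K)$ with $w\preceq x$ for all $x\in K$. Dipaths: a dipath in $K$ is a continuous map $\gamma:[0,1]\to K$ with $\gamma(s)\preceq\gamma(t)$ whenever $s\le t$. $\overrightarrow{P}_p^q(K)$ is the space of dipaths from $p$ to $q$ with the compact-open topology. Past link: for $v\in\mathbb{Z}^n$, $\mathrm{lk}^-_K(v):=\{j\in\{0,1\}^n\setminus\{\mathbf 0\} : [v-j,v]\subseteq K\}$, viewed as an abstract simplicial complex in which $j$ stands for the simplex $\{x_i : j_i=1\}$ on vertices among $x_1,\dots,x_n$. Collapse: $\tau$ is a free face of $\sigma$ if $\sigma$ is a maximal cube, $\tau$ is a proper face of $\sigma$, and no other maximal cube of $K$ contains $\tau$. In that case the $(\tau,\sigma)$-collapse of $K$ is the subcomplex $K'$ obtained from $K$ by removing all (open) cubes $\gamma\in\mathcal{K}$ with $\overline{\tau}\subseteq\overline{\gamma}\subseteq\overline{\sigma}$. $K'$ is a link-preserving directed collapse (LPDC) of $K$ if (the geometric realizations of) $\mathrm{lk}^-_K(v)$ and $\mathrm{lk}^-_{K'}(v)$ are homotopy equivalent for all $v\in\mathrm{verts}(K')$. *)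

theory Defs
  imports "HOL-Analysis.Analysis"
begin

text \<open>
  The ambient space is \<^typ>\<open>real ^ 'n\<close> with the library's componentwise order, so that
  \<^term>\<open>{p..q} :: (real ^ 'n) set\<close> is the order interval $[p,q]$.
\<close>

subsection \<open>Directed Euclidean cubical complexes\<close>

definition int_points :: "(real ^ 'n) set"
  where "int_points = {v. \<forall>i. v $ i \<in> \<int>}"

definition zero_one_vectors :: "(real ^ 'n) set"
  where "zero_one_vectors = {j. \<forall>i. j $ i \<in> {0, 1}}"

definition elementary_cubes :: "(real ^ 'n) set set"
  where "elementary_cubes = {{v - j..v} | v j. v \<in> int_points \<and> j \<in> zero_one_vectors}"

definition cubical_complex :: "(real ^ 'n) set \<Rightarrow> bool"
  where "cubical_complex K \<longleftrightarrow>
    (\<exists>\<C>. finite \<C> \<and> \<C> \<subseteq> elementary_cubes \<and> K = \<Union>\<C>) \<and> K \<subset> UNIV"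

text \<open>
  A stratum is an open cube. The corresponding closed cube is its \<^const>\<open>closure\<close>; all face
  relations below are between closures.
\<close>

definition strata :: "(real ^ 'n) set \<Rightarrow> (real ^ 'n) set set"
  where "strata K = rel_interior ` {c \<in> elementary_cubes. c \<subseteq> K}"

definition verts :: "(real ^ 'n) set \<Rightarrow> (real ^ 'n) set"
  where "verts K = K \<inter> int_points"

definition minimum_vertex :: "(real ^ 'n) set \<Rightarrow> real ^ 'n \<Rightarrow> bool"
  where "minimum_vertex K w \<longleftrightarrow> w \<in> verts K \<and> (\<forall>x\<in>K. w \<le> x)"

definition maximal_cube :: "(real ^ 'n) set \<Rightarrow> (real ^ 'n) set \<Rightarrow> bool"
  where "maximal_cube K \<sigma> \<longleftrightarrow>
    \<sigma> \<in> strata K \<and> \<not> (\<exists>\<rho>\<in>strata K. closure \<sigma> \<subset> closure \<rho>)"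

definition free_face :: "(real ^ 'n) set \<Rightarrow> (real ^ 'n) set \<Rightarrow> (real ^ 'n) set \<Rightarrow> bool"
  where "free_face K \<tau> \<sigma> \<longleftrightarrow>
    \<tau> \<in> strata K \<and> maximal_cube K \<sigma> \<and> closure \<tau> \<subset> closure \<sigma> \<and>
    (\<forall>\<rho>. maximal_cube K \<rho> \<and> closure \<tau> \<subseteq> closure \<rho> \<longrightarrow> \<rho> = \<sigma>)"

definition collapse :: "(real ^ 'n) set \<Rightarrow> (real ^ 'n) set \<Rightarrow> (real ^ 'n) set \<Rightarrow> (real ^ 'n) set"
  where "collapse K \<tau> \<sigma> =
    K - \<Union>{\<gamma> \<in> strata K. closure \<tau> \<subseteq> closure \<gamma> \<and> closure \<gamma> \<subseteq> closure \<sigma>}"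

subsection \<open>Past links\<close>

definition past_link :: "(real ^ 'n) set \<Rightarrow> real ^ 'n \<Rightarrow> (real ^ 'n) set"
  where "past_link K v = {j \<in> zero_one_vectors - {0}. {v - j..v} \<subseteq> K}"

text \<open>
  The vertex $x_i$ is represented by the index \<open>i\<close>, so an abstract simplicial complex is a set of
  nonempty subsets of \<open>'n\<close>; it is realized inside the standard simplex of \<^typ>\<open>real ^ 'n\<close>.
\<close>

definition past_link_complex :: "(real ^ 'n) set \<Rightarrow> real ^ 'n \<Rightarrow> 'n set set"
  where "past_link_complex K v = (\<lambda>j. {i. j $ i = 1}) ` past_link K v"

definition geometric_realization :: "'n set set \<Rightarrow> (real ^ 'n) set"
  where "geometric_realization \<Delta> = (\<Union>S\<in>\<Delta>. convex hull ((\<lambda>i. axis i 1) ` S))"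

definition LPDC :: "(real ^ 'n) set \<Rightarrow> (real ^ 'n) set \<Rightarrow> bool"
  where "LPDC K K' \<longleftrightarrow>
    (\<exists>\<tau> \<sigma>. free_face K \<tau> \<sigma> \<and> K' = collapse K \<tau> \<sigma>) \<and>
    (\<forall>v\<in>verts K'. geometric_realization (past_link_complex K v)
       homotopy_eqv geometric_realization (past_link_complex K' v))"

subsection \<open>Spaces of dipaths\<close>

definition compact_open_topology :: "'a topology \<Rightarrow> 'b topology \<Rightarrow> ('a \<Rightarrow> 'b) topology"
  where "compact_open_topology X Y = topology_generated_by
    {{f \<in> extensional (topspace X). continuous_map X Y f \<and> f ` C \<subseteq> U} | C U.
       compactin X C \<and> openin Y U}"

lemma topspace_compact_open_topology:
  "topspace (compact_open_topology X Y) =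
     {f \<in> extensional (topspace X). continuous_map X Y f}"
proof -
  have "compactin X {} \<and> openin Y {}" by simp
  then show ?thesis
    unfolding compact_open_topology_def topology_generated_by_topspace by blast
qed

definition dipaths :: "(real ^ 'n) set \<Rightarrow> real ^ 'n \<Rightarrow> real ^ 'n \<Rightarrow> (real \<Rightarrow> real ^ 'n) set"
  where "dipaths K p q =
    {\<gamma> \<in> extensional {0..1}.
       continuous_map (top_of_set {0..1}) (top_of_set K) \<gamma> \<and>
       mono_on {0..1} \<gamma> \<and> \<gamma> 0 = p \<and> \<gamma> 1 = q}"

definition dipath_space :: "(real ^ 'n) set \<Rightarrow> real ^ 'n \<Rightarrow> real ^ 'n \<Rightarrow> (real \<Rightarrow> real ^ 'n) topology"
  where "dipath_space K p q =
    subtopology (compact_open_topology (top_of_set {0..1}) (top_of_set K)) (dipaths K p q)"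

lemma topspace_dipath_space: "topspace (dipath_space K p q) = dipaths K p q"
  by (auto simp: dipath_space_def topspace_compact_open_topology dipaths_def)

text \<open>
  \<^const>\<open>contractible_space\<close> holds of the empty space. Here a contractible space is nonempty; this
  matters because \<^term>\<open>dipaths K w v\<close> is empty when \<open>v\<close> is unreachable from \<open>w\<close>.
\<close>

definition nonempty_contractible_space :: "'a topology \<Rightarrow> bool"
  where "nonempty_contractible_space X \<longleftrightarrow> topspace X \<noteq> {} \<and> contractible_space X"

end

theory Submission
  imports Defs
begin

text \<open>
  The dipath spaces with source \<open>w\<close> are all contractible iff all past links of vertices other than
  \<open>w\<close> are, and an LPDC respects the latter condition.

  For the equivalence, fix \<open>v \<noteq> w\<close> and assume that the dipath spaces from \<open>w\<close> to the lower corners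
  \<open>v - j\<close> of the cubes in the past link of \<open>v\<close> are contractible. A dipath ending in \<open>v\<close> runs, near \<open>v\<close>,
  through a single cube \<open>[v - j, v]\<close>, and recording the barycentric position at which it does so is a
  map to the realized link. A homotopy inverse is obtained as follows. Truncating a dipath at \<open>v - j\<close>
  (componentwise minimum) and continuing it along the diagonal of the cube makes it pass through
  \<open>v - j\<close>; the part before \<open>v - j\<close> can then be contracted. Doing this for all faces of the link, the
  largest first, each with a weight that depends only on the position in the link, deforms every
  dipath to one that depends only on that position: at each position some face has full weight, and
  its contraction forgets the dipath. The equivalence follows by induction on \<open>v\<close>.

  In a collapse, the only vertex that can disappear is \<open>\<tau>\<close> itself. If it is not the minimum of \<open>\<sigma>\<close>, its
  past link in \<open>K\<close> is a full simplex. If it is, then \<open>\<tau>\<close> is an isolated point of the past link of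
  a neighbouring vertex of \<open>\<sigma>\<close>, and neither side of the equivalence holds.
\<close>

subsection \<open>The topology of dipath spaces\<close>

text \<open>A path on the unit interval is continued constantly on both sides and becomes a bounded
  continuous function. Dipath spaces then become subsets of a metric space carrying the uniform
  distance, where the library's notions for sets, such as \<open>contractible\<close>, apply. For a
  discontinuous \<open>g\<close> the value is unspecified.\<close>

definition lift01 :: "(real \<Rightarrow> 'a::metric_space) \<Rightarrow> real \<Rightarrow>\<^sub>C 'a"
  where "lift01 g = Bcontfun (\<lambda>t. g (max 0 (min 1 t)))"

lemma apply_lift01:
  assumes "continuous_on {0..1} g"
  shows "apply_bcontfun (lift01 g) t = g (max 0 (min 1 t))"
proof -
  have "continuous_on UNIV (\<lambda>t. g (max 0 (min 1 t)))"
    by (rule continuous_on_compose2[OF assms]) (auto intro!: continuous_intros)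
  moreover have "bounded (range (\<lambda>t. g (max 0 (min 1 t))))"
  proof (rule bounded_subset)
    show "bounded (g ` {0..1})"
      using assms compact_continuous_image compact_imp_bounded by blast
    show "range (\<lambda>t. g (max 0 (min 1 t))) \<subseteq> g ` {0..1}" by auto
  qed
  ultimately show ?thesis
    unfolding lift01_def by (subst Bcontfun_inverse) (auto simp: bcontfun_def)
qed

lemma apply_lift01_unit [simp]:
  assumes "continuous_on {0..1} g" "0 \<le> t" "t \<le> 1"
  shows "apply_bcontfun (lift01 g) t = g t"
  using assms by (simp add: apply_lift01)

lemma continuous_on_slice:
  assumes "continuous_on (Z \<times> T) (\<lambda>(z, t). g z t)" "z \<in> Z"
  shows "continuous_on T (g z)"
proof -
  have "continuous_on T (\<lambda>t. (\<lambda>(z, t). g z t) (z, t))"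
    by (rule continuous_on_compose2[OF assms(1)]) (use assms in \<open>auto intro!: continuous_intros\<close>)
  then show ?thesis by simp
qed

text \<open>Tube lemma: compactness of the unit interval makes a jointly continuous family uniformly
  close in \<open>t\<close> for nearby parameters. Every family of dipaths below is shown continuous
  through this currying.\<close>

lemma continuous_on_lift01:
  fixes g :: "'z::topological_space \<Rightarrow> real \<Rightarrow> 'a::metric_space"
  assumes "continuous_on (Z \<times> {0..1}) (\<lambda>(z, t). g z t)"
  shows "continuous_on Z (\<lambda>z. lift01 (g z))"
  unfolding continuous_on_def
proof
  fix z assume z: "z \<in> Z"
  show "((\<lambda>z. lift01 (g z)) \<longlongrightarrow> lift01 (g z)) (at z within Z)"
  proof (rule tendstoI)
    fix e :: real assume e: "0 < e"
    obtain X0 where X0: "z \<in> X0" "open X0"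
      and d: "\<forall>x\<in>X0 \<inter> Z. \<forall>t\<in>{0..1}. dist (g x t) (g z t) \<le> e / 2"
      using continuous_on_prod_compactE[OF assms compact_Icc z, of "e/2"] e by auto
    have "dist (lift01 (g x)) (lift01 (g z)) < e" if "x \<in> X0 \<inter> Z" for x
    proof -
      have "dist (lift01 (g x)) (lift01 (g z)) \<le> e / 2"
      proof (rule dist_bound)
        fix t
        show "dist (apply_bcontfun (lift01 (g x)) t) (apply_bcontfun (lift01 (g z)) t) \<le> e / 2"
          using d that continuous_on_slice[OF assms] z by (auto simp: apply_lift01)
      qed
      then show ?thesis using e by simp
    qed
    then show "\<forall>\<^sub>F x in at z within Z. dist (lift01 (g x)) (lift01 (g z)) < e"
      using X0 by (auto simp: eventually_at_topological)
  qed
qed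

text \<open>Evaluation is jointly continuous: replacing \<open>F x\<close> by \<open>F z\<close>
  costs at most their uniform distance, and moving the argument uses only continuity of the single
  function \<open>F z\<close>.\<close>

lemma continuous_on_apply_bcontfun_compose [continuous_intros]:
  fixes F :: "'z::topological_space \<Rightarrow> ('b::topological_space \<Rightarrow>\<^sub>C 'a::metric_space)"
  assumes F: "continuous_on S F" and \<tau>: "continuous_on S \<tau>"
  shows "continuous_on S (\<lambda>z. apply_bcontfun (F z) (\<tau> z))"
  unfolding continuous_on_def
proof
  fix z assume z: "z \<in> S"
  show "((\<lambda>z. apply_bcontfun (F z) (\<tau> z)) \<longlongrightarrow> apply_bcontfun (F z) (\<tau> z)) (at z within S)"
  proof (rule tendstoI)
    fix e :: real assume e: "0 < e"
    have c: "continuous_on S (\<lambda>x. apply_bcontfun (F z) (\<tau> x))"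
      by (rule continuous_on_compose2[OF continuous_on_apply_bcontfun \<tau>, of UNIV]) auto
    have "\<forall>\<^sub>F x in at z within S. dist (F x) (F z) < e / 2"
      using F z e by (intro tendstoD) (auto simp: continuous_on_def)
    moreover have "\<forall>\<^sub>F x in at z within S. dist (apply_bcontfun (F z) (\<tau> x)) (apply_bcontfun (F z) (\<tau> z)) < e / 2"
      using c z e by (intro tendstoD) (auto simp: continuous_on_def)
    ultimately show "\<forall>\<^sub>F x in at z within S.
        dist (apply_bcontfun (F x) (\<tau> x)) (apply_bcontfun (F z) (\<tau> z)) < e"
    proof eventually_elim
      case (elim x)
      have "dist (apply_bcontfun (F x) (\<tau> x)) (apply_bcontfun (F z) (\<tau> x)) < e / 2"
        using dist_bounded[of "F x" "\<tau> x" "F z"] elim by linarith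
      then show ?case using elim dist_triangle_half_r
        by (metis dist_commute)
    qed
  qed
qed

text \<open>The first condition says that \<open>f\<close> is constant outside the unit interval, so
  that \<open>f\<close> is determined by a dipath and distinct points are distinct dipaths.\<close>

definition dipath_funs :: "(real ^ 'n) set \<Rightarrow> real ^ 'n \<Rightarrow> real ^ 'n \<Rightarrow> (real \<Rightarrow>\<^sub>C (real ^ 'n)) set"
  where "dipath_funs K p q = {f. (\<forall>t. apply_bcontfun f t = apply_bcontfun f (max 0 (min 1 t))) \<and>
    (\<forall>t\<in>{0..1}. apply_bcontfun f t \<in> K) \<and> mono_on {0..1} (apply_bcontfun f) \<and>
    apply_bcontfun f 0 = p \<and> apply_bcontfun f 1 = q}"

lemma lift01_in_dipath_funs:
  assumes "continuous_on {0..1} g" "\<And>t. t \<in> {0..1} \<Longrightarrow> g t \<in> K"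
    "mono_on {0..1} g" "g 0 = p" "g 1 = q"
  shows "lift01 g \<in> dipath_funs K p q"
  using assms by (auto simp: dipath_funs_def apply_lift01 mono_on_def)

lemma lift01_apply: "f \<in> dipath_funs K p q \<Longrightarrow> lift01 (apply_bcontfun f) = f"
  by (rule bcontfun_eqI) (auto simp: apply_lift01 dipath_funs_def)

lemma lift01_cong: "(\<And>t. t \<in> {0..1} \<Longrightarrow> g t = h t) \<Longrightarrow> lift01 g = lift01 h"
  unfolding lift01_def by (rule arg_cong[where f = Bcontfun]) auto

section \<open>Agreement of the compact-open and the uniform topology\<close>

lemma compact_open_subbasis_open:
  assumes "compactin X C" "openin Y U"
  shows "openin (compact_open_topology X Y)
    {f \<in> extensional (topspace X). continuous_map X Y f \<and> f ` C \<subseteq> U}"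
  unfolding compact_open_topology_def
  by (rule topology_generated_by_Basis) (use assms in blast)

text \<open>Uniform closeness implies closeness in the compact-open sense: the compact image of
  \<open>C\<close> keeps a positive distance from the complement of the open set \<open>V\<close>,
  and this distance is the radius wanted.\<close>

lemma continuous_map_restrict_dipath:
  "continuous_map (top_of_set (dipath_funs K p q)) (dipath_space K p q)
     (\<lambda>f. restrict (apply_bcontfun f) {0..1})"
proof -
  let ?r = "\<lambda>f. restrict (apply_bcontfun f) {0..1}"
  have mem: "?r f \<in> dipaths K p q" if "f \<in> dipath_funs K p q" for f
  proof -
    have "continuous_on {0..1} (?r f)"
      by (rule continuous_on_eq[OF continuous_on_apply_bcontfun[of _ f]]) auto
    then show ?thesis using that
      by (auto simp: dipaths_def dipath_funs_def image_subset_iff mono_on_def)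
  qed
  have "continuous_map (top_of_set (dipath_funs K p q))
      (compact_open_topology (top_of_set {0..1}) (top_of_set K)) ?r"
    unfolding compact_open_topology_def
  proof (rule continuous_on_generated_topo)
    fix W assume "W \<in> {{f \<in> extensional (topspace (top_of_set {0..1})).
        continuous_map (top_of_set {0..1}) (top_of_set K) f \<and> f ` C \<subseteq> U} | C U.
        compactin (top_of_set {0..1::real}) C \<and> openin (top_of_set K) U}"
    then obtain C U where C: "compact C" "C \<subseteq> {0..1}" and U: "openin (top_of_set K) U" and
      W: "W = {f \<in> extensional {0..1}.
        continuous_map (top_of_set {0..1}) (top_of_set K) f \<and> f ` C \<subseteq> U}"
      by (auto simp: compactin_subtopology)
    obtain V where V: "open V" "U = K \<inter> V" using U by (auto simp: openin_open)
    have eq: "?r -` W \<inter> dipath_funs K p q = {f \<in> dipath_funs K p q. \<forall>t\<in>C. apply_bcontfun f t \<in> V}"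
      using mem C by (auto simp: W V dipaths_def image_subset_iff dipath_funs_def subset_iff)
    have "openin (top_of_set (dipath_funs K p q)) {f \<in> dipath_funs K p q. \<forall>t\<in>C. apply_bcontfun f t \<in> V}"
      unfolding openin_euclidean_subtopology_iff
    proof safe
      fix f assume f: "f \<in> dipath_funs K p q" "\<forall>t\<in>C. apply_bcontfun f t \<in> V"
      have "compact (apply_bcontfun f ` C)" using C by (intro compact_continuous_image) auto
      then obtain e where e: "e > 0" "(\<Union>x\<in>apply_bcontfun f ` C. ball x e) \<subseteq> V"
        using compact_subset_open_imp_ball_epsilon_subset[of "apply_bcontfun f ` C" V] f V by blast
      show "\<exists>e>0. \<forall>g\<in>dipath_funs K p q. dist g f < e \<longrightarrow>
          g \<in> {f \<in> dipath_funs K p q. \<forall>t\<in>C. apply_bcontfun f t \<in> V}"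
      proof (intro exI conjI ballI impI)
        show "e > 0" by fact
        fix g assume g: "g \<in> dipath_funs K p q" "dist g f < e"
        have "apply_bcontfun g t \<in> V" if "t \<in> C" for t
        proof -
          have "apply_bcontfun g t \<in> ball (apply_bcontfun f t) e"
            using dist_bounded[of f t g] g by (auto simp: dist_commute)
          then show ?thesis using e that by blast
        qed
        then show "g \<in> {f \<in> dipath_funs K p q. \<forall>t\<in>C. apply_bcontfun f t \<in> V}" using g by auto
      qed
    qed
    then show "openin (top_of_set (dipath_funs K p q)) (?r -` W \<inter> topspace (top_of_set (dipath_funs K p q)))"
      by (simp add: eq)
  next
    show "?r ` topspace (top_of_set (dipath_funs K p q)) \<subseteq>
      \<Union> {{f \<in> extensional (topspace (top_of_set {0..1})).
        continuous_map (top_of_set {0..1}) (top_of_set K) f \<and> f ` C \<subseteq> U} | C U.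
        compactin (top_of_set {0..1::real}) C \<and> openin (top_of_set K) U}" (is "_ \<subseteq> ?R")
    proof -
      have "?R = topspace (compact_open_topology (top_of_set {0..1}) (top_of_set K))"
        unfolding compact_open_topology_def topology_generated_by_topspace ..
      moreover have "dipaths K p q
          \<subseteq> topspace (compact_open_topology (top_of_set {0..1}) (top_of_set K))"
        unfolding topspace_compact_open_topology by (auto simp: dipaths_def)
      ultimately show ?thesis using mem by auto
    qed
  qed
  then show ?thesis
    using mem by (auto simp: dipath_space_def continuous_map_in_subtopology)
qed

text \<open>Conversely, uniform continuity of \<open>g\<close> cuts the interval into finitely many
  pieces, each mapped into a small ball. Sending every piece into its ball is an intersection of
  finitely many subbasic open conditions, and it forces uniform closeness to
  \<open>g\<close>.\<close>

lemma continuous_map_lift01_dipath: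
  "continuous_map (dipath_space K p q) (top_of_set (dipath_funs K p q)) lift01"
proof -
  let ?T = "compact_open_topology (top_of_set {0..1::real}) (top_of_set K)"
  have cont: "continuous_on {0..1} g" if "g \<in> dipaths K p q" for g
    using that by (auto simp: dipaths_def)
  have mem: "lift01 g \<in> dipath_funs K p q" if "g \<in> dipaths K p q" for g
    by (rule lift01_in_dipath_funs) (use that in \<open>auto simp: dipaths_def\<close>)
  have "\<exists>W. openin (dipath_space K p q) W \<and> g \<in> W \<and> (\<forall>h\<in>W. lift01 h \<in> ball (lift01 g) e)"
    if g: "g \<in> dipaths K p q" and e: "e > 0" for g e
  proof -
    have "uniformly_continuous_on {0..1} g"
      using cont[OF g] compact_uniformly_continuous by blast
    then obtain d where d: "d > 0"
      "\<And>s t. s \<in> {0..1} \<Longrightarrow> t \<in> {0..1} \<Longrightarrow> dist t s < d \<Longrightarrow> dist (g t) (g s) < e / 3"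
      unfolding uniformly_continuous_on_def using e by (metis zero_less_divide_iff zero_less_numeral)
    obtain N where N: "N > 0" "1 / real N < d"
      using d(1) by (metis nat_approx_posE of_nat_0_less_iff zero_less_Suc)
    define C where "C = (\<lambda>k. {real k / N .. (real k + 1) / N})"
    define V where "V = (\<lambda>k. K \<inter> ball (g (real k / N)) (e / 3))"
    define B where "B = (\<lambda>k. {f \<in> extensional (topspace (top_of_set {0..1::real})).
      continuous_map (top_of_set {0..1}) (top_of_set K) f \<and> f ` C k \<subseteq> V k})"
    have C01: "C k \<subseteq> {0..1}" if "k < N" for k
    proof -
      have "real k + 1 \<le> N" using that by linarith
      then show ?thesis using N(1) by (auto simp: C_def field_simps intro: order_trans)
    qed
    have B: "openin ?T (B k)" if "k < N" for k
      unfolding B_def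
    proof (rule compact_open_subbasis_open)
      show "compactin (top_of_set {0..1}) (C k)"
        using C01[OF that] by (simp add: compactin_subtopology C_def)
      show "openin (top_of_set K) (V k)" unfolding V_def by (auto simp: openin_open)
    qed
    define W where "W = dipaths K p q \<inter> (\<Inter>k<N. B k)"
    have "openin (dipath_space K p q) W"
    proof -
      have "openin ?T (\<Inter>k<N. B k)" using B N(1) by (intro openin_INT2) auto
      then show ?thesis unfolding dipath_space_def W_def openin_subtopology by blast
    qed
    moreover have "g \<in> W"
    proof -
      have "g x \<in> V k" if k: "k < N" and x: "x \<in> C k" for k x
      proof -
        have x01: "x \<in> {0..1}" using C01[OF k] x by auto
        have k01: "real k / N \<in> {0..1}" using k by auto
        have "dist x (real k / N) < d"
          using x N by (auto simp: C_def dist_real_def add_divide_distrib)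
        then have "dist (g x) (g (real k / N)) < e / 3" by (rule d(2)[OF k01 x01])
        then show ?thesis using g x01 by (auto simp: V_def dist_commute dipaths_def)
      qed
      then show ?thesis using g by (auto simp: W_def B_def dipaths_def)
    qed
    moreover have "lift01 h \<in> ball (lift01 g) e" if h: "h \<in> W" for h
    proof -
      have hd: "h \<in> dipaths K p q" using h by (simp add: W_def)
      \<comment> \<open>Both values lie within \<open>e / 3\<close> of \<open>g (k / N)\<close>. The
        bound \<open>2 * e / 3\<close> leaves room because passing to the supremum only preserves a
        weak inequality.\<close>
      have *: "dist (h t) (g t) \<le> 2 * e / 3" if t: "t \<in> {0..1}" for t
      proof -
        obtain k where k: "k < N" "t \<in> C k"
        \<comment> \<open>The end point belongs to the last piece, with index \<open>N - 1\<close>;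
          rounding \<open>t * N\<close> down would give \<open>N\<close>.\<close>
        proof (cases "t = 1")
          case True
          show ?thesis by (rule that[of "N - 1"]) (use True N(1) in \<open>auto simp: C_def of_nat_diff field_simps\<close>)
        next
          case False
          define k where "k = nat \<lfloor>t * N\<rfloor>"
          have t01: "0 \<le> t" "t < 1" using t False by auto
          have "0 \<le> t * N" using t01 by simp
          then have k: "real k \<le> t * N" "t * N < real k + 1" unfolding k_def by linarith+
          have "t * N < N" using t01 N(1) by simp
          then have "k < N" using k by linarith
          then show ?thesis using that[of k] k N(1) by (auto simp: C_def field_simps)
        qed
        have "h t \<in> V k" using h k by (auto simp: W_def B_def)
        moreover have "g t \<in> V k" using \<open>g \<in> W\<close> k by (auto simp: W_def B_def)
        ultimately have "dist (g (k / N)) (h t) < e / 3" "dist (g (k / N)) (g t) < e / 3"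
          by (auto simp: V_def)
        then show ?thesis using dist_triangle3[of "h t" "g t" "g (k / N)"] by linarith
      qed
      have "dist (lift01 h) (lift01 g) \<le> 2 * e / 3"
        by (rule dist_bound) (use * cont g hd in \<open>auto simp: apply_lift01\<close>)
      then show ?thesis using e by (simp add: dist_commute)
    qed
    ultimately show ?thesis by blast
  qed
  then have "continuous_map (dipath_space K p q) euclidean (lift01 :: _ \<Rightarrow> (real \<Rightarrow>\<^sub>C (real ^ 'a)))"
    using Met_TC.continuous_map_to_metric[of "dipath_space K p q" lift01]
    by (simp add: topspace_dipath_space)
  then show ?thesis using mem
    by (auto simp: continuous_map_in_subtopology topspace_dipath_space)
qed

lemma homeomorphic_dipath_space:
  "dipath_space K p q homeomorphic_space top_of_set (dipath_funs K p q)"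
proof -
  have "homeomorphic_maps (dipath_space K p q) (top_of_set (dipath_funs K p q)) lift01
     (\<lambda>f. restrict (apply_bcontfun f) {0..1})"
    unfolding homeomorphic_maps_def
  proof (intro conjI ballI)
    fix g assume "g \<in> topspace (dipath_space K p q)"
    then have g: "g \<in> extensional {0..1}" "continuous_on {0..1} g"
      by (auto simp: topspace_dipath_space dipaths_def)
    show "restrict (apply_bcontfun (lift01 g)) {0..1} = g"
      by (rule extensionalityI[of _ "{0..1}"]) (use g in auto)
  next
    fix f assume "f \<in> topspace (top_of_set (dipath_funs K p q))"
    then have f: "f \<in> dipath_funs K p q" by simp
    have "lift01 (restrict (apply_bcontfun f) {0..1}) = lift01 (apply_bcontfun f)"
      by (rule lift01_cong) auto
    then show "lift01 (restrict (apply_bcontfun f) {0..1}) = f" using lift01_apply[OF f] by simp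
  qed (rule continuous_map_lift01_dipath continuous_map_restrict_dipath)+
  then show ?thesis unfolding homeomorphic_space_def by blast
qed

lemma nonempty_contractible_dipath_space:
  "nonempty_contractible_space (dipath_space K p q) \<longleftrightarrow>
     dipath_funs K p q \<noteq> {} \<and> contractible (dipath_funs K p q)"
proof -
  have "topspace (dipath_space K p q) = {} \<longleftrightarrow> topspace (top_of_set (dipath_funs K p q)) = {}"
    using homeomorphic_empty_space[OF homeomorphic_dipath_space[of K p q]]
    by (simp only: null_topspace_iff_trivial)
  then show ?thesis
    using homeomorphic_space_contractibility[OF homeomorphic_dipath_space[of K p q]]
    unfolding nonempty_contractible_space_def contractible_space_top_of_set topspace_euclidean_subtopology
    by blast
qed

subsection \<open>Cubes and past links\<close>

definition ind :: "'n set \<Rightarrow> real ^ 'n"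
  where "ind a = (\<chi> i. if i \<in> a then 1 else 0)"

lemma ind_nth [simp]: "ind a $ i = (if i \<in> a then 1 else 0)"
  by (simp add: ind_def)

lemma mem_Icc_vec: "x \<in> {p..q :: real ^ 'n} \<longleftrightarrow> (\<forall>i. p $ i \<le> x $ i \<and> x $ i \<le> q $ i)"
  by (auto simp: less_eq_vec_def)

lemma zero_one_vectors_eq: "zero_one_vectors = range ind"
proof (rule set_eqI)
  fix j :: "real ^ 'n"
  show "j \<in> zero_one_vectors \<longleftrightarrow> j \<in> range ind"
  proof
    assume "j \<in> zero_one_vectors"
    then have "j = ind {i. j $ i = 1}" by (auto simp: zero_one_vectors_def vec_eq_iff)
    then show "j \<in> range ind" by blast
  qed (auto simp: zero_one_vectors_def)
qed

lemma ind_in_int_points: "ind a \<in> int_points"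
  by (simp add: int_points_def)

lemma int_points_diff: "v \<in> int_points \<Longrightarrow> w \<in> int_points \<Longrightarrow> v - w \<in> int_points"
  by (simp add: int_points_def)

lemma int_points_add: "v \<in> int_points \<Longrightarrow> w \<in> int_points \<Longrightarrow> v + w \<in> int_points"
  by (simp add: int_points_def)

lemma Ints_less_imp: "(x::real) \<in> \<int> \<Longrightarrow> y \<in> \<int> \<Longrightarrow> x < y \<Longrightarrow> x + 1 \<le> y"
  by (auto elim!: Ints_cases)

lemma elementary_cubes_eq: "elementary_cubes = {{v - ind a..v} | v a. v \<in> int_points}"
  unfolding elementary_cubes_def zero_one_vectors_eq by blast

lemma ind_eq_0_iff: "ind a = 0 \<longleftrightarrow> a = {}"
  by (auto simp: vec_eq_iff)

lemma mem_past_link_complex: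
  "a \<in> past_link_complex K v \<longleftrightarrow> a \<noteq> {} \<and> {v - ind a..v} \<subseteq> K"
proof -
  have 1: "{i. ind b $ i = 1} = b" for b :: "'a set" by auto
  have "past_link K v = ind ` {a. a \<noteq> {} \<and> {v - ind a..v} \<subseteq> K}"
    unfolding past_link_def zero_one_vectors_eq by (auto simp: ind_eq_0_iff)
  then have "past_link_complex K v = (\<lambda>b. {i. ind b $ i = 1}) ` {a. a \<noteq> {} \<and> {v - ind a..v} \<subseteq> K}"
    by (simp only: past_link_complex_def image_image)
  then show ?thesis unfolding 1 by simp
qed

lemma past_link_complex_subset:
  assumes "a \<in> past_link_complex K v" "b \<subseteq> a" "b \<noteq> {}"
  shows "b \<in> past_link_complex K v"
proof -
  have "{v - ind b..v} \<subseteq> {v - ind a..v}"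
  proof (rule subsetI, unfold mem_Icc_vec, intro allI)
    fix x i assume x: "\<forall>i. (v - ind b) $ i \<le> x $ i \<and> x $ i \<le> v $ i"
    then show "(v - ind a) $ i \<le> x $ i \<and> x $ i \<le> v $ i"
      using spec[OF x, of i] assms(2) by (auto split: if_splits)
  qed
  then show ?thesis using assms unfolding mem_past_link_complex by blast
qed

text \<open>The coordinates of \<open>z\<close> are its barycentric coordinates with respect to the
  unit vectors.\<close>

lemma convex_hull_axis:
  "convex hull ((\<lambda>i. axis i 1) ` S) =
     {z :: real ^ 'n. (\<forall>i. 0 \<le> z $ i) \<and> (\<Sum>i\<in>UNIV. z $ i) = 1 \<and> (\<forall>i. i \<notin> S \<longrightarrow> z $ i = 0)}"
  (is "?L = ?R")
proof
  show "?L \<subseteq> ?R"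
  proof (rule hull_minimal)
    show "(\<lambda>i. axis i 1) ` S \<subseteq> ?R" by (auto simp: axis_def)
    show "convex ?R"
      unfolding convex_def by (auto simp: sum.distrib simp flip: sum_distrib_left)
  qed
  show "?R \<subseteq> ?L"
  proof
    fix z assume z: "z \<in> ?R"
    have s: "(\<Sum>i\<in>S. z $ i) = 1"
      using z sum.mono_neutral_left[of UNIV S "\<lambda>i. z $ i"] by auto
    have "z = (\<Sum>i\<in>UNIV. z $ i *\<^sub>R axis i 1)"
      by (simp add: vec_eq_iff axis_def if_distrib cong: if_cong)
    also have "\<dots> = (\<Sum>i\<in>S. z $ i *\<^sub>R axis i 1)"
      by (rule sum.mono_neutral_right) (use z in auto)
    also have "\<dots> \<in> ?L"
      by (rule convex_sum) (use z s in \<open>auto intro: hull_inc\<close>)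
    finally show "z \<in> ?L" .
  qed
qed

text \<open>The support of a point spans the smallest simplex containing it, and the complex is
  closed under nonempty subsets. So a point is realized exactly when its support is a
  simplex.\<close>

lemma geometric_realization_past_link:
  "geometric_realization (past_link_complex K v) =
     {z. (\<forall>i. 0 \<le> z $ i) \<and> (\<Sum>i\<in>UNIV. z $ i) = 1 \<and> {i. 0 < z $ i} \<in> past_link_complex K v}"
proof (rule set_eqI)
  fix z :: "real ^ 'a"
  have ne: "{i. 0 < z $ i} \<noteq> {}" if "\<forall>i. 0 \<le> z $ i" "(\<Sum>i\<in>UNIV. z $ i) = 1"
  proof
    assume "{i. 0 < z $ i} = {}"
    then have "\<forall>i. z $ i = 0" using that by (metis (mono_tags, lifting) emptyE less_eq_real_def mem_Collect_eq)
    then show False using that by simp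
  qed
  show "z \<in> geometric_realization (past_link_complex K v) \<longleftrightarrow>
      z \<in> {z. (\<forall>i. 0 \<le> z $ i) \<and> (\<Sum>i\<in>UNIV. z $ i) = 1 \<and> {i. 0 < z $ i} \<in> past_link_complex K v}"
  proof
    assume "z \<in> geometric_realization (past_link_complex K v)"
    then obtain S where S: "S \<in> past_link_complex K v" "\<forall>i. 0 \<le> z $ i" "(\<Sum>i\<in>UNIV. z $ i) = 1"
      "\<forall>i. i \<notin> S \<longrightarrow> z $ i = 0"
      unfolding geometric_realization_def convex_hull_axis by auto
    have "{i. 0 < z $ i} \<subseteq> S" using S(4) by force
    then show "z \<in> {z. (\<forall>i. 0 \<le> z $ i) \<and> (\<Sum>i\<in>UNIV. z $ i) = 1 \<and> {i. 0 < z $ i} \<in> past_link_complex K v}"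
      using S ne past_link_complex_subset by blast
  next
    assume z: "z \<in> {z. (\<forall>i. 0 \<le> z $ i) \<and> (\<Sum>i\<in>UNIV. z $ i) = 1 \<and> {i. 0 < z $ i} \<in> past_link_complex K v}"
    then have "\<forall>i. i \<notin> {i. 0 < z $ i} \<longrightarrow> z $ i = 0"
      by (simp add: not_less order.antisym)
    with z have "z \<in> convex hull ((\<lambda>i. axis i 1) ` {i. 0 < z $ i})"
      unfolding convex_hull_axis by blast
    then show "z \<in> geometric_realization (past_link_complex K v)"
      unfolding geometric_realization_def using z by blast
  qed
qed

text \<open>The form in which being a complex enters the arguments. The collapse has this property
  as well, see \<open>cube_union_collapse\<close>.\<close>

definition cube_union :: "(real ^ 'n) set \<Rightarrow> bool"
  where "cube_union K \<longleftrightarrow> (\<forall>x\<in>K. \<exists>u a. u \<in> int_points \<and> x \<in> {u - ind a..u} \<and> {u - ind a..u} \<subseteq> K)"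

section \<open>Dipaths near a fixed end point\<close>

locale dipath_target =
  fixes K :: "(real ^ 'n) set" and w v :: "real ^ 'n"
  assumes cubes: "cube_union K" and w_int: "w \<in> int_points" and w_min: "\<And>x. x \<in> K \<Longrightarrow> w \<le> x"
    and v_int: "v \<in> int_points"
begin

abbreviation P :: "(real \<Rightarrow>\<^sub>C (real ^ 'n)) set"
  where "P \<equiv> dipath_funs K w v"

definition deficit :: "real ^ 'n \<Rightarrow> real"
  where "deficit x = (\<Sum>i\<in>UNIV. v $ i - x $ i)"

text \<open>
  The directions in which a dipath still moves once its distance to \<open>v\<close> in the 1-norm is below 1.
\<close>

definition supp :: "(real \<Rightarrow>\<^sub>C (real ^ 'n)) \<Rightarrow> 'n set"
  where "supp f = {i. \<exists>t\<in>{0..1}. deficit (apply_bcontfun f t) < 1 \<and> apply_bcontfun f t $ i < v $ i}"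

lemma deficit_mono: "x \<le> y \<Longrightarrow> deficit y \<le> deficit x"
  unfolding deficit_def by (rule sum_mono) (auto simp: less_eq_vec_def)

lemma deficit_component:
  assumes "x \<le> v" shows "v $ i - x $ i \<le> deficit x"
  unfolding deficit_def by (rule member_le_sum) (use assms in \<open>auto simp: less_eq_vec_def\<close>)

lemma continuous_on_deficit [continuous_intros]:
  "continuous_on S g \<Longrightarrow> continuous_on S (\<lambda>x. deficit (g x))"
  unfolding deficit_def by (intro continuous_intros)

lemma deficit_v [simp]: "deficit v = 0"
  by (simp add: deficit_def)

lemma P_mono: "f \<in> P \<Longrightarrow> 0 \<le> s \<Longrightarrow> s \<le> t \<Longrightarrow> t \<le> 1 \<Longrightarrow> apply_bcontfun f s \<le> apply_bcontfun f t"
  by (auto simp: dipath_funs_def mono_on_def)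

lemma P_le: "f \<in> P \<Longrightarrow> 0 \<le> t \<Longrightarrow> t \<le> 1 \<Longrightarrow> apply_bcontfun f t \<le> v"
  using P_mono[of f t 1] by (auto simp: dipath_funs_def)

lemma P_ends: "f \<in> P \<Longrightarrow> apply_bcontfun f 0 = w" "f \<in> P \<Longrightarrow> apply_bcontfun f 1 = v"
  by (auto simp: dipath_funs_def)

lemma P_in: "f \<in> P \<Longrightarrow> 0 \<le> t \<Longrightarrow> t \<le> 1 \<Longrightarrow> apply_bcontfun f t \<in> K"
  by (auto simp: dipath_funs_def)

text \<open>Dipaths are monotone, so the earliest of finitely many witness times is a witness for
  all directions at once.\<close>

lemma supp_witness:
  assumes f: "f \<in> P" and a: "a \<subseteq> supp f"
  obtains t where "0 \<le> t" "t \<le> 1" "deficit (apply_bcontfun f t) < 1" "\<And>i. i \<in> a \<Longrightarrow> apply_bcontfun f t $ i < v $ i"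
proof (cases "a = {}")
  case True
  show ?thesis by (rule that[of 1]) (use True P_ends f in auto)
next
  case False
  have "\<forall>i\<in>a. \<exists>t\<in>{0..1}. deficit (apply_bcontfun f t) < 1 \<and> apply_bcontfun f t $ i < v $ i"
    using a by (auto simp: supp_def)
  then obtain \<tau> where \<tau>: "\<And>i. i \<in> a \<Longrightarrow> \<tau> i \<in> {0..1} \<and> deficit (apply_bcontfun f (\<tau> i)) < 1 \<and>
      apply_bcontfun f (\<tau> i) $ i < v $ i" by metis
  have "Min (\<tau> ` a) \<in> \<tau> ` a" using False by (intro Min_in) auto
  then obtain k where k: "k \<in> a" "\<tau> k = Min (\<tau> ` a)" by auto
  have le: "\<tau> k \<le> \<tau> i" if "i \<in> a" for i using that k(2) by simp
  show ?thesis
  proof (rule that[of "\<tau> k"])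
    fix i assume i: "i \<in> a"
    have "apply_bcontfun f (\<tau> k) \<le> apply_bcontfun f (\<tau> i)"
      using P_mono[OF f, of "\<tau> k" "\<tau> i"] le[OF i] \<tau>[OF i] \<tau>[OF k(1)] by simp
    then show "apply_bcontfun f (\<tau> k) $ i < v $ i"
      using \<tau>[OF i] by (auto simp: less_eq_vec_def intro: order_le_less_trans)
  qed (use \<tau>[OF k(1)] in auto)
qed

text \<open>Take any cube of \<open>K\<close> through \<open>x\<close>. Its end points and
  \<open>v\<close> are integral, and \<open>x\<close> is less than 1 below \<open>v\<close> in each
  direction. Where \<open>x\<close> is strictly below \<open>v\<close>, the cube must therefore span
  the whole unit interval below \<open>v $ i\<close>; elsewhere \<open>x $ i = v $ i\<close>
  already.\<close>

lemma near_cube: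
  assumes x: "x \<in> K" "x \<le> v" "deficit x < 1"
  shows "{v - ind {i. x $ i < v $ i}..v} \<subseteq> K"
proof -
  obtain u b where u: "u \<in> int_points" "x \<in> {u - ind b..u}" "{u - ind b..u} \<subseteq> K"
    using cubes x(1) unfolding cube_union_def by blast
  have "u $ i - ind b $ i \<le> v $ i - ind {i. x $ i < v $ i} $ i \<and> v $ i \<le> u $ i" for i
  proof -
    have ux: "u $ i - ind b $ i \<le> x $ i" "x $ i \<le> u $ i" using u(2) unfolding mem_Icc_vec by auto
    have vi: "v $ i \<in> \<int>" "u $ i \<in> \<int>" "ind b $ i \<in> \<int>"
      using v_int u(1) by (auto simp: int_points_def)
    show ?thesis
    proof (cases "x $ i < v $ i")
      case True
      have "v $ i - x $ i < 1" using deficit_component[OF x(2)] x(3) by (meson order_le_less_trans)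
      then have "v $ i \<le> u $ i" using ux vi Ints_less_imp[of "u $ i" "v $ i"] by (cases "u $ i < v $ i") auto
      moreover have "u $ i - ind b $ i \<le> v $ i - 1"
        using Ints_less_imp[of "u $ i - ind b $ i" "v $ i"] True ux vi by (auto simp: Ints_diff)
      ultimately show ?thesis using True by simp
    next
      case False
      then have "x $ i = v $ i" using x(2) by (meson less_eq_vec_def linorder_not_less nle_le)
      then show ?thesis using ux by simp
    qed
  qed
  then have "{v - ind {i. x $ i < v $ i}..v} \<subseteq> {u - ind b..u}"
    unfolding subset_iff mem_Icc_vec vector_minus_component by (meson order_trans)
  then show ?thesis using u(3) by blast
qed

lemma supp_cube:
  assumes f: "f \<in> P"
  shows "{v - ind (supp f)..v} \<subseteq> K"
proof -
  obtain t where t: "0 \<le> t" "t \<le> 1" "deficit (apply_bcontfun f t) < 1"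
    "\<And>i. i \<in> supp f \<Longrightarrow> apply_bcontfun f t $ i < v $ i"
    using supp_witness[OF f order_refl] by blast
  have "supp f = {i. apply_bcontfun f t $ i < v $ i}" using t by (auto simp: supp_def)
  then show ?thesis using near_cube[OF P_in[OF f t(1,2)] P_le[OF f t(1,2)] t(3)] by simp
qed

text \<open>Distinct lattice points have 1-norm distance at least 1, so by the intermediate value
  theorem the dipath passes a point of deficit \<open>1 / 2\<close>, which differs from
  \<open>v\<close>.\<close>

lemma supp_nonempty:
  assumes f: "f \<in> P" and "v \<noteq> w"
  shows "supp f \<noteq> {}"
proof -
  have wv: "w \<le> v" using P_mono[OF f, of 0 1] P_ends[OF f] by simp
  have "\<exists>i. w $ i < v $ i"
    using wv assms(2) by (metis less_eq_vec_def order_less_le vec_eq_iff)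
  then obtain i where "w $ i + 1 \<le> v $ i"
    using Ints_less_imp[of "w $ i" "v $ i" for i] w_int v_int by (auto simp: int_points_def)
  then have "1 \<le> deficit w" using deficit_component[OF wv, of i] by simp
  moreover have "continuous_on {0..1} (\<lambda>t. deficit (apply_bcontfun f t))"
    by (intro continuous_intros)
  ultimately obtain t where t: "0 \<le> t" "t \<le> 1" "deficit (apply_bcontfun f t) = 1 / 2"
    using IVT2'[of "\<lambda>t. deficit (apply_bcontfun f t)" 1 "1/2" 0] P_ends[OF f] by auto
  have "\<exists>i. apply_bcontfun f t $ i < v $ i"
  proof (rule ccontr)
    assume "\<not> (\<exists>i. apply_bcontfun f t $ i < v $ i)"
    then have "deficit (apply_bcontfun f t) \<le> 0"
      unfolding deficit_def by (intro sum_nonpos) (auto simp: not_less)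
    then show False using t by simp
  qed
  then show ?thesis using t by (force simp: supp_def)
qed

lemma supp_in_past_link:
  assumes "f \<in> P" "v \<noteq> w" shows "supp f \<in> past_link_complex K v"
  using assms supp_cube supp_nonempty by (auto simp: mem_past_link_complex)

section \<open>Truncating dipaths and continuing them along a diagonal\<close>

definition cap :: "'n set \<Rightarrow> real \<Rightarrow> real ^ 'n \<Rightarrow> real ^ 'n"
  where "cap a l x = (\<chi> i. min (x $ i) (v $ i - (if i \<in> a then l else 0)))"

lemma cap_nth [simp]: "cap a l x $ i = min (x $ i) (v $ i - (if i \<in> a then l else 0))"
  by (simp add: cap_def)

lemma cap_0: "x \<le> v \<Longrightarrow> cap a 0 x = x"
  by (auto simp: vec_eq_iff less_eq_vec_def min_def intro: antisym)

lemma continuous_on_cap [continuous_intros]: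
  assumes "continuous_on S l" "continuous_on S x"
  shows "continuous_on S (\<lambda>z. cap a (l z) (x z))"
proof -
  have "continuous_on S (\<lambda>z. if i \<in> a then l z else 0)" for i
    using assms by (cases "i \<in> a") auto
  then show ?thesis
    unfolding cap_def using assms by (intro continuous_intros) auto
qed

text \<open>While all directions of \<open>a\<close> are strictly below \<open>v\<close>, the cube
  of \<open>K\<close> through the point has lower end at most \<open>v $ i - 1\<close> in these
  directions, so lowering the point to \<open>v $ i - l\<close> stays in that cube. Once some
  direction of \<open>a\<close> has arrived, the dipath is past a witness time for
  \<open>supp f\<close> and runs in the cube \<open>{v - ind (supp f)..v}\<close>, which truncation
  respects.\<close>

lemma cap_in:
  assumes f: "f \<in> P" and a: "a \<subseteq> supp f" and t: "0 \<le> t" "t \<le> 1" and l: "0 \<le> l" "l \<le> 1"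
  shows "cap a l (apply_bcontfun f t) \<in> K"
proof (cases "\<forall>i\<in>a. apply_bcontfun f t $ i < v $ i")
  case True
  let ?x = "apply_bcontfun f t"
  obtain u b where u: "u \<in> int_points" "?x \<in> {u - ind b..u}" "{u - ind b..u} \<subseteq> K"
    using cubes P_in[OF f t] unfolding cube_union_def by blast
  have xv: "?x $ i \<le> v $ i" for i using P_le[OF f t] by (simp add: less_eq_vec_def)
  have "u $ i - ind b $ i \<le> cap a l ?x $ i \<and> cap a l ?x $ i \<le> u $ i" for i
  proof -
    have ux: "u $ i - ind b $ i \<le> ?x $ i" "?x $ i \<le> u $ i" using u(2) unfolding mem_Icc_vec by auto
    have vi: "v $ i \<in> \<int>" "u $ i - ind b $ i \<in> \<int>"
      using v_int u(1) by (auto simp: int_points_def)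
    have "u $ i - ind b $ i \<le> v $ i - l" if "i \<in> a"
      using Ints_less_imp[OF vi(2,1)] True that ux l by force
    then show ?thesis using ux xv[of i] by (auto simp: min_le_iff_disj)
  qed
  then have "cap a l ?x \<in> {u - ind b..u}" unfolding mem_Icc_vec vector_minus_component by blast
  then show ?thesis using u(3) by blast
next
  case False
  then obtain k where k: "k \<in> a" "v $ k \<le> apply_bcontfun f t $ k" by (auto simp: not_less)
  obtain s where s: "0 \<le> s" "s \<le> 1" "deficit (apply_bcontfun f s) < 1"
    "\<And>i. i \<in> supp f \<Longrightarrow> apply_bcontfun f s $ i < v $ i"
    using supp_witness[OF f order_refl] by blast
  have st: "s \<le> t"
  proof (rule ccontr)
    assume "\<not> s \<le> t"
    then have "apply_bcontfun f t \<le> apply_bcontfun f s" using P_mono[OF f] t s by auto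
    moreover have "apply_bcontfun f s $ k < v $ k" using s(4) k(1) a by blast
    ultimately show False using k(2) unfolding less_eq_vec_def by (metis linorder_not_less order_trans)
  qed
  have le: "apply_bcontfun f s $ i \<le> apply_bcontfun f t $ i" "apply_bcontfun f t $ i \<le> v $ i" for i
    using P_mono[OF f s(1) st t(2)] P_le[OF f t] by (auto simp: less_eq_vec_def)
  have "v $ i - ind (supp f) $ i \<le> cap a l (apply_bcontfun f t) $ i \<and>
      cap a l (apply_bcontfun f t) $ i \<le> v $ i" for i
  proof (cases "i \<in> supp f")
    case True
    have "v $ i - apply_bcontfun f s $ i < 1"
      using deficit_component[OF P_le[OF f s(1,2)], of i] s(3) by linarith
    then show ?thesis using le[of i] True l by (auto simp: min_le_iff_disj)
  next
    case False
    have "apply_bcontfun f s $ i \<ge> v $ i" using False s by (force simp: supp_def)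
    then show ?thesis using le[of i] False a by (auto simp: min_le_iff_disj)
  qed
  then have "cap a l (apply_bcontfun f t) \<in> {v - ind (supp f)..v}" unfolding mem_Icc_vec vector_minus_component by blast
  then show ?thesis using supp_cube[OF f] by blast
qed

text \<open>By integrality \<open>w\<close> is at least 1 below \<open>v\<close> in every direction
  of \<open>a\<close>, so truncation does not move the start.\<close>

lemma cap_w:
  assumes f: "f \<in> P" and a: "a \<subseteq> supp f" and l: "0 \<le> l" "l \<le> 1"
  shows "cap a l w = w"
proof -
  obtain s where s: "0 \<le> s" "s \<le> 1" "deficit (apply_bcontfun f s) < 1"
    "\<And>i. i \<in> supp f \<Longrightarrow> apply_bcontfun f s $ i < v $ i"
    using supp_witness[OF f order_refl] by blast
  have "min (w $ i) (v $ i - (if i \<in> a then l else 0)) = w $ i" for i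
  proof (cases "i \<in> a")
    case True
    have "w $ i < v $ i"
      using P_mono[OF f, of 0 s] P_ends[OF f] s a True
      by (auto simp: less_eq_vec_def intro: order_le_less_trans)
    then have "w $ i + 1 \<le> v $ i" using Ints_less_imp w_int v_int by (auto simp: int_points_def)
    then show ?thesis using True l by simp
  next
    case False
    have "w \<le> v" using P_le[OF f, of 0] P_ends[OF f] by simp
    then show ?thesis using False by (simp add: less_eq_vec_def)
  qed
  then show ?thesis by (simp add: vec_eq_iff)
qed

text \<open>
  For \<open>u = 1\<close> the dipath \<open>push a f u\<close> runs through \<open>f\<close>, truncated at \<open>v - ind a\<close>, in the first half
  of the time, and through the diagonal from \<open>v - ind a\<close> to \<open>v\<close> in the second half; cf. \<open>push_1\<close>.
\<close>

definition push :: "'n set \<Rightarrow> (real \<Rightarrow>\<^sub>C (real ^ 'n)) \<Rightarrow> real \<Rightarrow> real \<Rightarrow>\<^sub>C (real ^ 'n)"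
  where "push a f u = lift01 (\<lambda>t. cap a (u * min 1 (2 - 2 * t)) (apply_bcontfun f (min 1 ((1 + u) * t))))"

text \<open>\<open>cut\<close> and \<open>ext\<close> are the two factors of
  \<open>push a f 1\<close>. Between them, at dipaths ending in \<open>v - ind a\<close>, a
  contraction can be inserted.\<close>

definition cut :: "'n set \<Rightarrow> (real \<Rightarrow>\<^sub>C (real ^ 'n)) \<Rightarrow> real \<Rightarrow>\<^sub>C (real ^ 'n)"
  where "cut a f = lift01 (\<lambda>t. cap a 1 (apply_bcontfun f t))"

definition ext :: "'n set \<Rightarrow> (real \<Rightarrow>\<^sub>C (real ^ 'n)) \<Rightarrow> real \<Rightarrow>\<^sub>C (real ^ 'n)"
  where "ext a g = lift01 (\<lambda>t. apply_bcontfun g (min 1 (2 * t)) + max 0 (2 * t - 1) *\<^sub>R ind a)"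

lemma continuous_on_push [continuous_intros]:
  assumes "continuous_on S f" "continuous_on S u"
  shows "continuous_on S (\<lambda>z. push a (f z) (u z))"
  unfolding push_def
proof (rule continuous_on_lift01)
  have "continuous_on (S \<times> {0..1}) (\<lambda>z. f (fst z))" "continuous_on (S \<times> {0..1}) (\<lambda>z. u (fst z))"
    using assms by (auto intro!: continuous_on_compose2[OF _ continuous_on_fst[OF continuous_on_id]])
  then show "continuous_on (S \<times> {0..1})
     (\<lambda>(z, t). cap a (u z * min 1 (2 - 2 * t)) (apply_bcontfun (f z) (min 1 ((1 + u z) * t))))"
    unfolding case_prod_unfold by (intro continuous_intros)
qed

lemma continuous_on_cut [continuous_intros]:
  assumes "continuous_on S f"
  shows "continuous_on S (\<lambda>z. cut a (f z))"
  unfolding cut_def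
proof (rule continuous_on_lift01)
  have "continuous_on (S \<times> {0..1}) (\<lambda>z. f (fst z))"
    using assms by (auto intro!: continuous_on_compose2[OF _ continuous_on_fst[OF continuous_on_id]])
  then show "continuous_on (S \<times> {0..1}) (\<lambda>(z, t). cap a 1 (apply_bcontfun (f z) t))"
    unfolding case_prod_unfold by (intro continuous_intros)
qed

lemma continuous_on_ext [continuous_intros]:
  assumes "continuous_on S f"
  shows "continuous_on S (\<lambda>z. ext a (f z))"
  unfolding ext_def
proof (rule continuous_on_lift01)
  have "continuous_on (S \<times> {0..1}) (\<lambda>z. f (fst z))"
    using assms by (auto intro!: continuous_on_compose2[OF _ continuous_on_fst[OF continuous_on_id]])
  then show "continuous_on (S \<times> {0..1})
     (\<lambda>(z, t). apply_bcontfun (f z) (min 1 (2 * t)) + max 0 (2 * t - 1) *\<^sub>R ind a)"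
    unfolding case_prod_unfold by (intro continuous_intros)
qed

lemma push_apply:
  "0 \<le> t \<Longrightarrow> t \<le> 1 \<Longrightarrow> apply_bcontfun (push a f u) t =
     cap a (u * min 1 (2 - 2 * t)) (apply_bcontfun f (min 1 ((1 + u) * t)))"
  unfolding push_def by (rule apply_lift01_unit) (intro continuous_intros | simp)+

lemma cut_apply:
  "0 \<le> t \<Longrightarrow> t \<le> 1 \<Longrightarrow> apply_bcontfun (cut a f) t = cap a 1 (apply_bcontfun f t)"
  unfolding cut_def by (rule apply_lift01_unit) (auto intro!: continuous_on_cap continuous_on_const)

lemma ext_apply:
  "0 \<le> t \<Longrightarrow> t \<le> 1 \<Longrightarrow> apply_bcontfun (ext a g) t =
     apply_bcontfun g (min 1 (2 * t)) + max 0 (2 * t - 1) *\<^sub>R ind a"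
  unfolding ext_def by (rule apply_lift01_unit) (intro continuous_intros | simp)+

lemma push_0: "f \<in> P \<Longrightarrow> push a f 0 = f"
proof -
  assume f: "f \<in> P"
  have "push a f 0 = lift01 (apply_bcontfun f)"
    unfolding push_def by (rule lift01_cong) (use P_le[OF f] in \<open>auto simp: cap_0\<close>)
  then show ?thesis using lift01_apply[OF f] by simp
qed

lemma cap_mono: "x \<le> y \<Longrightarrow> l' \<le> l \<Longrightarrow> cap a l x \<le> cap a l' y"
  by (auto simp: less_eq_vec_def min_le_iff_disj)

text \<open>The truncation level \<open>u * min 1 (2 - 2 * t)\<close> decreases in \<open>t\<close>
  while the reparametrized \<open>f\<close> increases, so monotonicity survives. At
  \<open>t = 1\<close> the level is 0 and the end point is \<open>v\<close> again.\<close>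

lemma push_in:
  assumes f: "f \<in> P" and a: "a \<subseteq> supp f" and u: "0 \<le> u" "u \<le> 1"
  shows "push a f u \<in> P"
  unfolding push_def
proof (rule lift01_in_dipath_funs)
  have l: "0 \<le> u * min 1 (2 - 2 * t)" "u * min 1 (2 - 2 * t) \<le> 1" if "t \<in> {0..1}" for t :: real
    using that u by (auto intro: mult_le_one)
  show "continuous_on {0..1} (\<lambda>t. cap a (u * min 1 (2 - 2 * t)) (apply_bcontfun f (min 1 ((1 + u) * t))))"
    by (intro continuous_intros)
  show "cap a (u * min 1 (2 - 2 * t)) (apply_bcontfun f (min 1 ((1 + u) * t))) \<in> K" if "t \<in> {0..1}" for t
    by (rule cap_in[OF f a]) (use that u l[OF that] in auto)
  show "mono_on {0..1} (\<lambda>t. cap a (u * min 1 (2 - 2 * t)) (apply_bcontfun f (min 1 ((1 + u) * t))))"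
  proof (rule mono_onI)
    fix r s :: real assume rs: "r \<in> {0..1}" "s \<in> {0..1}" "r \<le> s"
    have "min 1 ((1 + u) * r) \<le> min 1 ((1 + u) * s)"
      using rs u by (intro min.mono mult_left_mono) auto
    then show "cap a (u * min 1 (2 - 2 * r)) (apply_bcontfun f (min 1 ((1 + u) * r))) \<le>
        cap a (u * min 1 (2 - 2 * s)) (apply_bcontfun f (min 1 ((1 + u) * s)))"
      using rs u by (intro cap_mono P_mono[OF f] mult_left_mono) auto
  qed
  show "cap a (u * min 1 (2 - 2 * 0)) (apply_bcontfun f (min 1 ((1 + u) * 0))) = w"
    using cap_w[OF f a u] P_ends[OF f] by simp
  show "cap a (u * min 1 (2 - 2 * 1)) (apply_bcontfun f (min 1 ((1 + u) * 1))) = v"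
    using u P_ends[OF f] by (simp add: cap_0)
qed

text \<open>
  Times close to 1 suffice, because the deficit tends to 0 there.
\<close>

lemma supp_finalI:
  assumes f: "f \<in> P" and r: "0 \<le> r" "r < 1"
    and less: "\<And>t i. r < t \<Longrightarrow> t < 1 \<Longrightarrow> i \<in> a \<Longrightarrow> apply_bcontfun f t $ i < v $ i"
  shows "a \<subseteq> supp f"
proof -
  have "((\<lambda>t. deficit (apply_bcontfun f t)) \<longlongrightarrow> deficit (apply_bcontfun f 1)) (at 1 within {r<..<1})"
    by (rule continuous_on_tendsto_compose[of UNIV "\<lambda>t. deficit (apply_bcontfun f t)"])
       (auto intro!: continuous_intros tendsto_ident_at)
  then have "\<forall>\<^sub>F t in at 1 within {r<..<1}. deficit (apply_bcontfun f t) < 1"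
    using P_ends[OF f] by (intro order_tendstoD) auto
  moreover have "\<forall>\<^sub>F t in at 1 within {r<..<1}. t \<in> {r<..<1}"
    by (simp add: eventually_at_filter)
  moreover have "at 1 within {r<..<1} \<noteq> bot" using r by (simp add: at_within_eq_bot_iff)
  ultimately obtain t where "deficit (apply_bcontfun f t) < 1" "t \<in> {r<..<1}"
    using eventually_happens[of "\<lambda>t. deficit (apply_bcontfun f t) < 1 \<and> t \<in> {r<..<1}"] eventually_conj by blast
  then show ?thesis using less r by (force simp: supp_def)
qed

text \<open>For positive \<open>u\<close> the truncation level is positive before time 1, so the
  directions of \<open>a\<close> keep moving until the end. Conversely the pushed dipath lies below
  \<open>f\<close> at the corresponding time, so a small deficit passes to \<open>f\<close>, and
  only directions of \<open>a\<close> can newly fall below \<open>v\<close>.\<close>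

lemma supp_push:
  assumes f: "f \<in> P" and a: "a \<subseteq> supp f" and u: "0 \<le> u" "u \<le> 1"
  shows "a \<subseteq> supp (push a f u)" "supp (push a f u) \<subseteq> supp f \<union> a"
proof -
  show "a \<subseteq> supp (push a f u)"
  proof (cases "u = 0")
    case True
    then show ?thesis using push_0 f a by simp
  next
    case False
    show ?thesis
    proof (rule supp_finalI[of _ 0])
      fix t :: real and i assume t: "0 < t" "t < 1" and i: "i \<in> a"
      have "0 < u * min 1 (2 - 2 * t)" using False u t by auto
      then show "apply_bcontfun (push a f u) t $ i < v $ i"
        using t i by (auto simp: push_apply min_less_iff_disj)
    qed (use push_in[OF f a u] in auto)
  qed
  show "supp (push a f u) \<subseteq> supp f \<union> a"
  proof
    fix i assume "i \<in> supp (push a f u)"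
    then obtain t where t: "t \<in> {0..1}" "deficit (apply_bcontfun (push a f u) t) < 1"
      "apply_bcontfun (push a f u) t $ i < v $ i" by (auto simp: supp_def)
    let ?s = "min 1 ((1 + u) * t)"
    have s: "?s \<in> {0..1}" using t u by auto
    have "apply_bcontfun (push a f u) t \<le> apply_bcontfun f ?s"
      using t by (simp add: push_apply less_eq_vec_def)
    then have "deficit (apply_bcontfun f ?s) < 1" using deficit_mono t by force
    moreover have "apply_bcontfun f ?s $ i < v $ i \<or> i \<in> a"
      using t P_le[OF f, of ?s] s by (auto simp: push_apply min_less_iff_disj split: if_splits)
    ultimately show "i \<in> supp f \<union> a" using s by (auto simp: supp_def)
  qed
qed

lemma cut_in:
  assumes f: "f \<in> P" and a: "a \<subseteq> supp f"
  shows "cut a f \<in> dipath_funs K w (v - ind a)"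
  unfolding cut_def
proof (rule lift01_in_dipath_funs)
  show "continuous_on {0..1} (\<lambda>t. cap a 1 (apply_bcontfun f t))" by (intro continuous_intros)
  show "cap a 1 (apply_bcontfun f t) \<in> K" if "t \<in> {0..1}" for t
    by (rule cap_in[OF f a]) (use that in auto)
  show "mono_on {0..1} (\<lambda>t. cap a 1 (apply_bcontfun f t))"
    by (rule mono_onI) (intro cap_mono P_mono[OF f]; auto)
  show "cap a 1 (apply_bcontfun f 0) = w"
    using cap_w[OF f a, of 1] P_ends[OF f] by simp
  show "cap a 1 (apply_bcontfun f 1) = v - ind a"
    using P_ends[OF f] by (auto simp: vec_eq_iff)
qed

lemma ext_in:
  assumes a: "{v - ind a..v} \<subseteq> K" and g: "g \<in> dipath_funs K w (v - ind a)"
  shows "ext a g \<in> P"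
  unfolding ext_def
proof (rule lift01_in_dipath_funs)
  have g1: "apply_bcontfun g 0 = w" "apply_bcontfun g 1 = v - ind a"
    and g2: "\<And>t. 0 \<le> t \<Longrightarrow> t \<le> 1 \<Longrightarrow> apply_bcontfun g t \<in> K"
    and g3: "\<And>s t. 0 \<le> s \<Longrightarrow> s \<le> t \<Longrightarrow> t \<le> 1 \<Longrightarrow> apply_bcontfun g s \<le> apply_bcontfun g t"
    using g by (auto simp: dipath_funs_def mono_on_def)
  show "continuous_on {0..1} (\<lambda>t. apply_bcontfun g (min 1 (2 * t)) + max 0 (2 * t - 1) *\<^sub>R ind a)"
    by (intro continuous_intros)
  show "apply_bcontfun g (min 1 (2 * t)) + max 0 (2 * t - 1) *\<^sub>R ind a \<in> K" if t: "t \<in> {0..1}" for t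
  proof (cases "2 * t \<le> 1")
    case True
    then show ?thesis using g2[of "2 * t"] t by simp
  next
    case False
    then have "apply_bcontfun g (min 1 (2 * t)) + max 0 (2 * t - 1) *\<^sub>R ind a =
        v - ind a + (2 * t - 1) *\<^sub>R ind a" using g1 by simp
    also have "\<dots> \<in> {v - ind a..v}" unfolding mem_Icc_vec using False t by auto
    finally show ?thesis using a by blast
  qed
  show "mono_on {0..1} (\<lambda>t. apply_bcontfun g (min 1 (2 * t)) + max 0 (2 * t - 1) *\<^sub>R ind a)"
  proof (rule mono_onI)
    fix r s :: real assume rs: "r \<in> {0..1}" "s \<in> {0..1}" "r \<le> s"
    have "apply_bcontfun g (min 1 (2 * r)) \<le> apply_bcontfun g (min 1 (2 * s))"
      using rs by (intro g3) auto
    then show "apply_bcontfun g (min 1 (2 * r)) + max 0 (2 * r - 1) *\<^sub>R ind a \<le>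
        apply_bcontfun g (min 1 (2 * s)) + max 0 (2 * s - 1) *\<^sub>R ind a"
      using rs by (auto simp: less_eq_vec_def intro!: add_mono)
  qed
qed (use g in \<open>auto simp: dipath_funs_def\<close>)

text \<open>On the diagonal exactly the directions of \<open>a\<close> are below \<open>v\<close>.
  Before it the dipath is below \<open>v - ind a\<close>, where the deficit is at least 1 because
  \<open>a\<close> is nonempty, so these times do not count.\<close>

lemma supp_ext:
  assumes a: "{v - ind a..v} \<subseteq> K" "a \<noteq> {}" and g: "g \<in> dipath_funs K w (v - ind a)"
  shows "supp (ext a g) = a"
proof
  have g1: "apply_bcontfun g 1 = v - ind a"
    and g3: "\<And>s t. 0 \<le> s \<Longrightarrow> s \<le> t \<Longrightarrow> t \<le> 1 \<Longrightarrow> apply_bcontfun g s \<le> apply_bcontfun g t"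
    using g by (auto simp: dipath_funs_def mono_on_def)
  have late: "apply_bcontfun (ext a g) t = v - (2 - 2 * t) *\<^sub>R ind a" if "1/2 < t" "t \<le> 1" for t
    using that g1 by (simp add: ext_apply vec_eq_iff)
  show "a \<subseteq> supp (ext a g)"
    by (rule supp_finalI[of _ "1/2"]) (use ext_in[OF a(1) g] late in auto)
  show "supp (ext a g) \<subseteq> a"
  proof
    fix i assume "i \<in> supp (ext a g)"
    then obtain t where t: "t \<in> {0..1}" "deficit (apply_bcontfun (ext a g) t) < 1"
      "apply_bcontfun (ext a g) t $ i < v $ i" by (auto simp: supp_def)
    show "i \<in> a"
    proof (cases "1/2 < t")
      case True
      then show ?thesis using t late[of t] by (auto split: if_splits)
    next
      case False
      have le: "apply_bcontfun (ext a g) t \<le> v - ind a"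
        using g3[of "2 * t" 1] g1 False t by (simp add: ext_apply)
      obtain k where "k \<in> a" using a(2) by blast
      have v: "v - ind a \<le> v" by (simp add: less_eq_vec_def)
      have "1 \<le> deficit (v - ind a)"
        using deficit_component[OF v, of k] \<open>k \<in> a\<close> by simp
      then show ?thesis using deficit_mono[OF le] t by simp
    qed
  qed
qed

text \<open>For \<open>u = 1\<close> the dipath \<open>f\<close> has reached \<open>v\<close> at
  time \<open>1 / 2\<close>; afterwards only the decreasing truncation level acts, and it traces the
  diagonal.\<close>

lemma push_1:
  assumes f: "f \<in> P"
  shows "push a f 1 = ext a (cut a f)"
  unfolding push_def ext_def
proof (rule lift01_cong)
  fix t :: real assume t: "t \<in> {0..1}"
  show "cap a (1 * min 1 (2 - 2 * t)) (apply_bcontfun f (min 1 ((1 + 1) * t))) =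
      apply_bcontfun (cut a f) (min 1 (2 * t)) + max 0 (2 * t - 1) *\<^sub>R ind a"
  proof (cases "2 * t \<le> 1")
    case True
    then show ?thesis using t by (simp add: cut_apply)
  next
    case False
    then show ?thesis using t P_ends[OF f] by (auto simp: cut_apply vec_eq_iff)
  qed
qed

end

subsection \<open>Deformation of the dipaths onto the past link\<close>

text \<open>Positive exactly when the coordinates in \<open>a\<close> are positive and exceed all
  others, and equal to 2 once these gaps reach \<open>1 / (n * (n + 1))\<close>, where
  \<open>n\<close> is the dimension. The range from 0 to 2 is the parameter range of a deformation
  with two stages: pushing up to 1, contracting up to 2.\<close>

definition weight :: "'n set \<Rightarrow> real ^ 'n \<Rightarrow> real"
  where "weight a z =
    (let c = real CARD('n) * (real CARD('n) + 1); clamp = (\<lambda>x. max 0 (min 1 (c * x))) in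
      2 * (\<Prod>i\<in>a. clamp (z $ i)) * (\<Prod>i\<in>a. \<Prod>k\<in>-a. clamp (z $ i - z $ k)))"

lemma continuous_on_weight [continuous_intros]:
  "continuous_on S z \<Longrightarrow> continuous_on S (\<lambda>x. weight a (z x))"
  unfolding weight_def Let_def by (intro continuous_intros) auto

lemma weight_bounds: "0 \<le> weight a z" "weight a z \<le> 2"
proof -
  let ?c = "\<lambda>x::real. max 0 (min 1 (real CARD('a) * (real CARD('a) + 1) * x))"
  have "0 \<le> (\<Prod>i\<in>a. ?c (z $ i))" "(\<Prod>i\<in>a. ?c (z $ i)) \<le> 1"
    "0 \<le> (\<Prod>i\<in>a. \<Prod>k\<in>-a. ?c (z $ i - z $ k))" "(\<Prod>i\<in>a. \<Prod>k\<in>-a. ?c (z $ i - z $ k)) \<le> 1"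
    by (auto intro!: prod_nonneg prod_le_1)
  then show "0 \<le> weight a z" "weight a z \<le> 2"
    unfolding weight_def Let_def by (auto intro: mult_le_one)
qed

lemma weight_pos:
  fixes z :: "real ^ 'n"
  assumes "0 < weight a z" "i \<in> a"
  shows "0 < z $ i" "k \<notin> a \<Longrightarrow> z $ k < z $ i"
proof -
  let ?c = "\<lambda>x::real. max 0 (min 1 (real CARD('n) * (real CARD('n) + 1) * x))"
  have c: "?c x = 0" if "x \<le> 0" for x
  proof -
    have "real CARD('n) * (real CARD('n) + 1) * x \<le> 0" using that by (intro mult_nonneg_nonpos) auto
    then show ?thesis by simp
  qed
  have "2 * (\<Prod>i\<in>a. ?c (z $ i)) * (\<Prod>i\<in>a. \<Prod>k\<in>-a. ?c (z $ i - z $ k)) \<noteq> 0"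
    using less_imp_neq[OF assms(1)] unfolding weight_def Let_def by (rule not_sym)
  then have "(\<Prod>i\<in>a. ?c (z $ i)) \<noteq> 0" "(\<Prod>i\<in>a. \<Prod>k\<in>-a. ?c (z $ i - z $ k)) \<noteq> 0"
    by (simp_all only: mult_eq_0_iff de_Morgan_disj not_False_eq_True)
  then have *: "?c (z $ i) \<noteq> 0" "\<And>k. k \<notin> a \<Longrightarrow> ?c (z $ i - z $ k) \<noteq> 0"
    using assms(2) by (simp_all add: prod_zero_iff)
  show "0 < z $ i" using *(1) c[of "z $ i"] by linarith
  show "z $ k < z $ i" if "k \<notin> a" using *(2)[OF that] c[of "z $ i - z $ k"] by linarith
qed

text \<open>Sets of positive weight are upper level sets of the coordinates of \<open>z\<close>,
  hence nested. Otherwise \<open>i\<close> in \<open>a\<close> only and \<open>k\<close> in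
  \<open>b\<close> only would satisfy both \<open>z $ k < z $ i\<close> and
  \<open>z $ i < z $ k\<close>.\<close>

lemma weight_chain:
  assumes "0 < weight a z" "0 < weight b z" "card b \<le> card a"
  shows "b \<subseteq> a"
proof (rule ccontr)
  assume "\<not> b \<subseteq> a"
  then obtain k where k: "k \<in> b" "k \<notin> a" by blast
  have "\<not> a \<subseteq> b"
  proof
    assume "a \<subseteq> b"
    then have "a \<subset> b" using k by blast
    then show False using psubset_card_mono[of b a] assms(3) by auto
  qed
  then obtain i where i: "i \<in> a" "i \<notin> b" by blast
  show False using weight_pos(2)[OF assms(1) i(1) k(2)] weight_pos(2)[OF assms(2) k(1) i(2)] by simp
qed

lemma weight_eq_2I:
  fixes z :: "real ^ 'n"
  assumes "\<And>i. i \<in> a \<Longrightarrow> 1 \<le> real CARD('n) * (real CARD('n) + 1) * z $ i"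
    "\<And>i k. i \<in> a \<Longrightarrow> k \<notin> a \<Longrightarrow> 1 \<le> real CARD('n) * (real CARD('n) + 1) * (z $ i - z $ k)"
  shows "weight a z = 2"
proof -
  let ?c = "\<lambda>x::real. max 0 (min 1 (real CARD('n) * (real CARD('n) + 1) * x))"
  have "(\<Prod>i\<in>a. ?c (z $ i)) = 1" using assms(1) by (intro prod.neutral) auto
  moreover have "(\<Prod>i\<in>a. \<Prod>k\<in>-a. ?c (z $ i - z $ k)) = 1"
    using assms(2) by (intro prod.neutral ballI) auto
  ultimately show ?thesis unfolding weight_def Let_def by simp
qed

text \<open>
  Pigeonhole: one of \<open>n + 1\<close> intervals of length \<open>1 / (n (n + 1))\<close> contains none of the \<open>n\<close>
  coordinates of \<open>z\<close>; take the coordinates above it.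
\<close>

lemma exists_weight_2:
  fixes z :: "real ^ 'n"
  assumes nonneg: "\<And>i. 0 \<le> z $ i" and sum: "(\<Sum>i\<in>UNIV. z $ i) = 1"
  obtains a where "a \<noteq> {}" "weight a z = 2"
proof -
  define n where "n = CARD('n)"
  define c where "c = real n * (real n + 1)"
  have n: "n > 0" unfolding n_def by simp
  have c: "c > 0" unfolding c_def using n by simp
  define F where "F = (\<lambda>i. nat \<lfloor>c * z $ i\<rfloor>)"
  have "card (range F) \<le> n" unfolding n_def by (rule card_image_le) simp
  then have "card (range F) < card {0..n}" by simp
  then have "\<not> {0..n} \<subseteq> range F" by (meson card_mono finite finite_imageI not_le)
  then obtain k where "k \<in> {0..n}" and k: "k \<notin> range F" by blast
  then have k: "k \<le> n" "k \<notin> range F" by simp_all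
  have gap: "c * z $ i < k \<or> real k + 1 \<le> c * z $ i" for i
  proof -
    have "F i \<noteq> k" using k(2) by blast
    moreover have "0 \<le> c * z $ i" using c nonneg by simp
    ultimately show ?thesis unfolding F_def by linarith
  qed
  define a where "a = {i. real k + 1 \<le> c * z $ i}"
  have "a \<noteq> {}"
  proof
    assume "a = {}"
    \<comment> \<open>This explains the constant: if nothing lies above the gap, then
      \<open>c * z $ i < k + 1 \<le> n + 1\<close>, that is \<open>z $ i < 1 / n\<close>, and the
      sum would be below 1.\<close>
    have "z $ i < 1 / (real n)" for i
    proof -
      have "i \<notin> a" using \<open>a = {}\<close> by blast
      then have "c * z $ i < real n + 1" using k(1) by (simp add: a_def)
      then have "(real n + 1) * (real n * z $ i) < (real n + 1) * 1" by (simp add: c_def algebra_simps)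
      then have "real n * z $ i < 1" by (subst (asm) mult_less_cancel_left_pos) auto
      then show ?thesis using n by (simp add: field_simps)
    qed
    then have "(\<Sum>i\<in>UNIV. z $ i) < (\<Sum>i\<in>(UNIV::'n set). 1 / real n)"
      by (intro sum_strict_mono) auto
    then show False using sum n by (simp add: n_def)
  qed
  moreover have "weight a z = 2"
  proof (rule weight_eq_2I)
    fix i assume "i \<in> a"
    then have i: "real k + 1 \<le> c * z $ i" by (simp add: a_def)
    then show "1 \<le> real CARD('n) * (real CARD('n) + 1) * z $ i"
      unfolding n_def[symmetric] c_def[symmetric] by linarith
    fix j assume "j \<notin> a"
    then have "c * z $ j < k" using gap[of j] by (simp add: a_def)
    then show "1 \<le> real CARD('n) * (real CARD('n) + 1) * (z $ i - z $ j)"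
      using i unfolding n_def[symmetric] c_def[symmetric] by (simp add: right_diff_distrib)
  qed
  ultimately show ?thesis by (rule that)
qed

text \<open>The order in which the faces are treated, largest first. Together with
  \<open>weight_chain\<close>, a later face of positive weight is contained in every earlier one of
  positive weight.\<close>

lemma exists_decreasing_labels:
  obtains as :: "'n::finite set list"
  where "set as = {a. a \<noteq> {}}" "sorted_wrt (\<lambda>a b. card b \<le> card a) as"
proof -
  obtain xs :: "'n set list" where xs: "set xs = {a. a \<noteq> {}}"
    using finite_list[OF finite[of "{a :: 'n set. a \<noteq> {}}"]] by blast
  have "sorted_wrt (\<lambda>a b. - int (card a) \<le> - int (card b)) (sort_key (\<lambda>a. - int (card a)) xs)"
    using sorted_sort_key[of "\<lambda>a. - int (card a)" xs] by (simp only: sorted_wrt_map)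
  then have "sorted_wrt (\<lambda>a b. card b \<le> card a) (sort_key (\<lambda>a. - int (card a)) xs)"
    by (rule sorted_wrt_mono_rel[rotated]) simp
  then show ?thesis using that[of "sort_key (\<lambda>a. - int (card a)) xs"] xs by simp
qed

section \<open>The barycentric position of a dipath near its end\<close>

context dipath_target
begin

text \<open>
  The norm is a supremum over the dipath and depends continuously on it.
\<close>

definition coord :: "(real \<Rightarrow>\<^sub>C (real ^ 'n)) \<Rightarrow> 'n \<Rightarrow> real"
  where "coord f i = norm (lift01 (\<lambda>t. max 0 (min (v $ i - apply_bcontfun f t $ i) (1 - deficit (apply_bcontfun f t)))))"

text \<open>For a dipath to \<open>v \<noteq> w\<close> the positive coordinates are those in
  \<open>supp f\<close>, so normalising yields a point in the interior of the simplex
  \<open>supp f\<close> of the past link.\<close>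

definition proj :: "(real \<Rightarrow>\<^sub>C (real ^ 'n)) \<Rightarrow> real ^ 'n"
  where "proj f = (\<chi> i. coord f i / (\<Sum>k\<in>UNIV. coord f k))"

lemma continuous_on_coord [continuous_intros]:
  assumes "continuous_on S f"
  shows "continuous_on S (\<lambda>z. coord (f z) i)"
  unfolding coord_def
proof (intro continuous_on_norm continuous_on_lift01)
  have "continuous_on (S \<times> {0..1}) (\<lambda>z. f (fst z))"
    using assms by (auto intro!: continuous_on_compose2[OF _ continuous_on_fst[OF continuous_on_id]])
  then show "continuous_on (S \<times> {0..1}) (\<lambda>(z, t). max 0 (min (v $ i - apply_bcontfun (f z) t $ i)
      (1 - deficit (apply_bcontfun (f z) t))))"
    unfolding case_prod_unfold by (intro continuous_intros)
qed

lemma coord_nonneg: "0 \<le> coord f i"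
  by (simp add: coord_def)

text \<open>A norm vanishes only at the zero function, and the function under the norm is nonzero at
  \<open>t\<close> exactly when \<open>t\<close> witnesses \<open>i \<in> supp f\<close>.\<close>

lemma coord_pos_iff: "0 < coord f i \<longleftrightarrow> i \<in> supp f"
proof -
  define g where "g = (\<lambda>t. max 0 (min (v $ i - apply_bcontfun f t $ i) (1 - deficit (apply_bcontfun f t))))"
  have g: "continuous_on {0..1} g" unfolding g_def by (intro continuous_intros)
  have "0 < coord f i \<longleftrightarrow> lift01 g \<noteq> 0" by (simp add: coord_def g_def)
  also have "\<dots> \<longleftrightarrow> (\<exists>t. g (max 0 (min 1 t)) \<noteq> 0)"
    using bcontfun_eqI[of "lift01 g" 0] apply_lift01[OF g] zero_bcontfun.rep_eq by metis
  also have "\<dots> \<longleftrightarrow> (\<exists>t\<in>{0..1}. g t \<noteq> 0)"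
  proof
    assume "\<exists>t. g (max 0 (min 1 t)) \<noteq> 0"
    then obtain t where "g (max 0 (min 1 t)) \<noteq> 0" by blast
    then show "\<exists>t\<in>{0..1}. g t \<noteq> 0" by (intro bexI[of _ "max 0 (min 1 t)"]) auto
  next
    assume "\<exists>t\<in>{0..1}. g t \<noteq> 0"
    then obtain t where t: "t \<in> {0..1}" "g t \<noteq> 0" by blast
    then have "max 0 (min 1 t) = t" by auto
    then show "\<exists>t. g (max 0 (min 1 t)) \<noteq> 0" using t by metis
  qed
  also have "\<dots> \<longleftrightarrow> i \<in> supp f" 
  proof -
    have "g t \<noteq> 0 \<longleftrightarrow> deficit (apply_bcontfun f t) < 1 \<and> apply_bcontfun f t $ i < v $ i" for t
      unfolding g_def by (smt (verit))
    then show ?thesis by (simp add: supp_def)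
  qed
  finally show ?thesis .
qed

end

section \<open>Single deformation steps, given contractions at the lower corners\<close>

locale dipath_target_contractions = dipath_target K w v
  for K :: "(real ^ 'n) set" and w v +
  fixes h :: "'n set \<Rightarrow> real \<times> (real \<Rightarrow>\<^sub>C (real ^ 'n)) \<Rightarrow> (real \<Rightarrow>\<^sub>C (real ^ 'n))"
    and p :: "'n set \<Rightarrow> (real \<Rightarrow>\<^sub>C (real ^ 'n))"
  assumes vw: "v \<noteq> w"
    and h_cont: "\<And>a. a \<in> past_link_complex K v \<Longrightarrow>
      continuous_on ({0..1} \<times> dipath_funs K w (v - ind a)) (h a)"
    and h_in: "\<And>a r g. a \<in> past_link_complex K v \<Longrightarrow> 0 \<le> r \<Longrightarrow> r \<le> 1 \<Longrightarrow>
      g \<in> dipath_funs K w (v - ind a) \<Longrightarrow> h a (r, g) \<in> dipath_funs K w (v - ind a)"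
    and h_0: "\<And>a g. a \<in> past_link_complex K v \<Longrightarrow> g \<in> dipath_funs K w (v - ind a) \<Longrightarrow> h a (0, g) = g"
    and h_1: "\<And>a g. a \<in> past_link_complex K v \<Longrightarrow> g \<in> dipath_funs K w (v - ind a) \<Longrightarrow> h a (1, g) = p a"
    and p_in: "\<And>a. a \<in> past_link_complex K v \<Longrightarrow> p a \<in> dipath_funs K w (v - ind a)"
begin

abbreviation L :: "'n set set" where "L \<equiv> past_link_complex K v"
abbreviation S :: "(real ^ 'n) set" where "S \<equiv> geometric_realization L"

lemma L_cube: "a \<in> L \<Longrightarrow> {v - ind a..v} \<subseteq> K" "a \<in> L \<Longrightarrow> a \<noteq> {}"
  by (auto simp: mem_past_link_complex)

lemma sub_supp_in_L: "f \<in> P \<Longrightarrow> a \<subseteq> supp f \<Longrightarrow> a \<noteq> {} \<Longrightarrow> a \<in> L"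
  using past_link_complex_subset supp_in_past_link vw by blast

text \<open>For \<open>u\<close> up to 1 the dipath is pushed through \<open>v - ind a\<close>; from
  1 to 2 its part before that corner is contracted by \<open>h a\<close>. At \<open>u = 2\<close>
  the result is \<open>q a\<close>, whatever \<open>f\<close> was.\<close>

definition step :: "'n set \<Rightarrow> (real \<Rightarrow>\<^sub>C (real ^ 'n)) \<Rightarrow> real \<Rightarrow> real \<Rightarrow>\<^sub>C (real ^ 'n)"
  where "step a f u = (if u \<le> 1 then push a f u else ext a (h a (u - 1, cut a f)))"

definition q :: "'n set \<Rightarrow> real \<Rightarrow>\<^sub>C (real ^ 'n)"
  where "q a = ext a (p a)"

lemma q_in: "a \<in> L \<Longrightarrow> q a \<in> P" and supp_q: "a \<in> L \<Longrightarrow> supp (q a) = a"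
  unfolding q_def using ext_in supp_ext L_cube p_in by auto

lemma step_0: "f \<in> P \<Longrightarrow> step a f 0 = f"
  by (simp add: step_def push_0)

lemma step_2: "f \<in> P \<Longrightarrow> a \<subseteq> supp f \<Longrightarrow> a \<noteq> {} \<Longrightarrow> step a f 2 = q a"
  by (simp add: step_def q_def h_1 cut_in sub_supp_in_L)

lemma step_props:
  assumes f: "f \<in> P" and a: "a \<subseteq> supp f" "a \<noteq> {}" and u: "0 \<le> u" "u \<le> 2"
  shows "step a f u \<in> P" "a \<subseteq> supp (step a f u)" "supp (step a f u) \<subseteq> supp f \<union> a"
proof -
  note aL = sub_supp_in_L[OF f a]
  have h: "h a (u - 1, cut a f) \<in> dipath_funs K w (v - ind a)" if "\<not> u \<le> 1"
    by (rule h_in[OF aL]) (use that u cut_in[OF f a(1)] in auto)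
  show "step a f u \<in> P"
    using push_in[OF f a(1), of u] ext_in[OF L_cube(1)[OF aL] h] u by (simp add: step_def)
  show "a \<subseteq> supp (step a f u)" "supp (step a f u) \<subseteq> supp f \<union> a"
    using supp_push[OF f a(1), of u] supp_ext[OF L_cube[OF aL] h] u by (auto simp: step_def)
qed

text \<open>The two formulas are glued along \<open>\<mu> z = 1\<close>, where \<open>push_1\<close>
  and \<open>h_0\<close> make them agree. Where \<open>\<mu> z \<ge> 1\<close>, the face
  \<open>a\<close> lies in the support, so \<open>cut\<close> lands in the domain of
  \<open>h a\<close>.\<close>

lemma continuous_on_step:
  assumes d: "continuous_on Z d" and \<mu>: "continuous_on Z \<mu>" and a: "a \<noteq> {}"
    and adm: "\<And>z. z \<in> Z \<Longrightarrow> d z \<in> P \<and> 0 \<le> \<mu> z \<and> \<mu> z \<le> 2 \<and> (0 < \<mu> z \<longrightarrow> a \<subseteq> supp (d z))"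
  shows "continuous_on Z (\<lambda>z. step a (d z) (\<mu> z))"
  unfolding step_def
proof (rule continuous_on_cases_le[OF _ _ \<mu>])
  show "continuous_on {t \<in> Z. \<mu> t \<le> 1} (\<lambda>z. push a (d z) (\<mu> z))"
    by (intro continuous_intros continuous_on_subset[OF d] continuous_on_subset[OF \<mu>]) auto
  have sup: "a \<subseteq> supp (d z)" if "z \<in> Z" "1 \<le> \<mu> z" for z
    using adm[OF that(1)] that(2) by auto
  show "continuous_on {t \<in> Z. 1 \<le> \<mu> t} (\<lambda>z. ext a (h a (\<mu> z - 1, cut a (d z))))"
  \<comment> \<open>A point of this region provides \<open>a \<in> L\<close>, and with it the
    continuity of \<open>h a\<close>.\<close>
  proof (cases "{t \<in> Z. 1 \<le> \<mu> t} = {}")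
    case True
    then show ?thesis by (simp only: continuous_on_empty)
  next
    case False
    then obtain z where z: "z \<in> Z" "1 \<le> \<mu> z" by blast
    have aL: "a \<in> L" using sub_supp_in_L[OF _ sup[OF z] a] adm[OF z(1)] by blast
    have "continuous_on {t \<in> Z. 1 \<le> \<mu> t} (\<lambda>z. h a (\<mu> z - 1, cut a (d z)))"
    proof (rule continuous_on_compose2[OF h_cont[OF aL]])
      show "continuous_on {t \<in> Z. 1 \<le> \<mu> t} (\<lambda>z. (\<mu> z - 1, cut a (d z)))"
        by (intro continuous_intros continuous_on_subset[OF d] continuous_on_subset[OF \<mu>]) auto
      show "(\<lambda>z. (\<mu> z - 1, cut a (d z))) ` {t \<in> Z. 1 \<le> \<mu> t} \<subseteq> {0..1} \<times> dipath_funs K w (v - ind a)"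
        using adm sup cut_in by fastforce
    qed
    then show ?thesis by (rule continuous_on_ext)
  qed
  fix z assume z: "z \<in> Z" "\<mu> z = 1"
  have "a \<subseteq> supp (d z)" using sup z by simp
  moreover have "d z \<in> P" using adm z by blast
  ultimately show "push a (d z) (\<mu> z) = ext a (h a (\<mu> z - 1, cut a (d z)))"
    using z(2) push_1 h_0 cut_in sub_supp_in_L a by simp
qed

section \<open>Successive steps along a list of faces\<close>

primrec runs :: "'n set list \<Rightarrow> ('n set \<Rightarrow> real) \<Rightarrow> (real \<Rightarrow>\<^sub>C (real ^ 'n)) \<Rightarrow> (real \<Rightarrow>\<^sub>C (real ^ 'n))"
  where
    "runs [] \<mu> f = f"
  | "runs (a # as) \<mu> f = runs as \<mu> (step a f (\<mu> a))"

text \<open>The invariant under which the steps can be chained: faces with positive parameter lie in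
  the support, and they shrink along the list.\<close>

definition admissible :: "'n set list \<Rightarrow> ('n set \<Rightarrow> real) \<Rightarrow> (real \<Rightarrow>\<^sub>C (real ^ 'n)) \<Rightarrow> bool"
  where "admissible as \<mu> f \<longleftrightarrow> f \<in> P \<and>
    (\<forall>a\<in>set as. a \<noteq> {} \<and> 0 \<le> \<mu> a \<and> \<mu> a \<le> 2 \<and> (0 < \<mu> a \<longrightarrow> a \<subseteq> supp f)) \<and>
    sorted_wrt (\<lambda>a b. 0 < \<mu> a \<longrightarrow> 0 < \<mu> b \<longrightarrow> b \<subseteq> a) as"

text \<open>A step with positive parameter keeps \<open>a\<close> in the support, and every later
  face of positive parameter is contained in \<open>a\<close>. A step with parameter 0 changes
  nothing.\<close>

lemma admissible_step:
  assumes "admissible (a # as) \<mu> f"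
  shows "admissible as \<mu> (step a f (\<mu> a))"
proof (cases "\<mu> a = 0")
  case True
  then show ?thesis using assms by (simp add: admissible_def step_0)
next
  case False
  have a: "f \<in> P" "a \<noteq> {}" "0 < \<mu> a" "\<mu> a \<le> 2" "a \<subseteq> supp f"
    using assms False by (auto simp: admissible_def)
  note s = step_props[OF a(1,5,2) _ a(4)]
  show ?thesis
    using assms s a(3) unfolding admissible_def by simp (meson order_trans)
qed

lemma runs_props:
  assumes "admissible as \<mu> f"
  shows "runs as \<mu> f \<in> P" "supp (runs as \<mu> f) \<subseteq> supp f \<union> \<Union>{a \<in> set as. 0 < \<mu> a}"
proof -
  have "runs as \<mu> f \<in> P \<and> supp (runs as \<mu> f) \<subseteq> supp f \<union> \<Union>{a \<in> set as. 0 < \<mu> a}"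
    using assms
  proof (induction as arbitrary: f)
    case Nil
    then show ?case by (simp add: admissible_def)
  next
    case (Cons a as)
    have a: "f \<in> P" "a \<noteq> {}" "0 \<le> \<mu> a" "\<mu> a \<le> 2" "0 < \<mu> a \<longrightarrow> a \<subseteq> supp f"
      using Cons.prems by (auto simp: admissible_def)
    have "supp (step a f (\<mu> a)) \<subseteq> supp f \<union> (if 0 < \<mu> a then a else {})"
    proof (cases "\<mu> a = 0")
      case True
      then show ?thesis using a(1) by (simp add: step_0)
    next
      case False
      then show ?thesis using step_props(3)[OF a(1) _ a(2-4)] a by auto
    qed
    then show ?case using Cons.IH[OF admissible_step[OF Cons.prems]] by (auto split: if_splits)
  qed
  then show "runs as \<mu> f \<in> P" "supp (runs as \<mu> f) \<subseteq> supp f \<union> \<Union>{a \<in> set as. 0 < \<mu> a}" by auto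
qed

lemma continuous_on_runs:
  assumes "continuous_on Z d" "\<And>a. a \<in> set as \<Longrightarrow> continuous_on Z (\<lambda>z. \<mu> z a)"
    "\<And>z. z \<in> Z \<Longrightarrow> admissible as (\<mu> z) (d z)"
  shows "continuous_on Z (\<lambda>z. runs as (\<mu> z) (d z))"
  using assms
proof (induction as arbitrary: d)
  case Nil
  then show ?case by simp
next
  case (Cons a as)
  have "continuous_on Z (\<lambda>z. step a (d z) (\<mu> z a))"
  proof (cases "Z = {}")
    case False
    then have "a \<noteq> {}" using Cons.prems(3) by (auto simp: admissible_def)
    then show ?thesis
      by (intro continuous_on_step Cons.prems) (use Cons.prems(3) in \<open>auto simp: admissible_def\<close>)
  qed simp
  then have "continuous_on Z (\<lambda>z. runs as (\<mu> z) (step a (d z) (\<mu> z a)))"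
    by (rule Cons.IH) (use Cons.prems admissible_step in auto)
  then show ?case by simp
qed

lemma runs_0: "f \<in> P \<Longrightarrow> (\<And>a. a \<in> set as \<Longrightarrow> \<mu> a = 0) \<Longrightarrow> runs as \<mu> f = f"
  by (induction as) (auto simp: step_0)

text \<open>The steps before \<open>a\<close> only change the dipath that arrives at
  \<open>a\<close>, and a step with parameter 2 replaces that dipath by \<open>q a\<close>.\<close>

lemma runs_forget:
  assumes "admissible (as @ a # bs) \<mu> f" "\<mu> a = 2"
  shows "runs (as @ a # bs) \<mu> f = runs bs \<mu> (q a)" "a \<in> L" "admissible bs \<mu> (q a)"
proof -
  have "runs (as @ a # bs) \<mu> f = runs bs \<mu> (q a) \<and> a \<in> L \<and> admissible bs \<mu> (q a)"
    using assms(1)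
  proof (induction as arbitrary: f)
    case Nil
    have "f \<in> P" "a \<noteq> {}" "a \<subseteq> supp f" using Nil assms(2) by (auto simp: admissible_def)
    then have "step a f (\<mu> a) = q a" "a \<in> L" using step_2 sub_supp_in_L assms(2) by auto
    then show ?case using admissible_step[of a bs \<mu> f] Nil by simp
  next
    case (Cons b as)
    then show ?case using admissible_step[of b "as @ a # bs" \<mu> f] by simp
  qed
  then show "runs (as @ a # bs) \<mu> f = runs bs \<mu> (q a)" "a \<in> L" "admissible bs \<mu> (q a)" by auto
qed

section \<open>Homotopy equivalence of dipaths and the realized past link\<close>

lemma mem_S: "z \<in> S \<longleftrightarrow> (\<forall>i. 0 \<le> z $ i) \<and> (\<Sum>i\<in>UNIV. z $ i) = 1 \<and> {i. 0 < z $ i} \<in> L"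
  by (simp add: geometric_realization_past_link)

lemma compact_S: "compact S"
  unfolding geometric_realization_def by (intro compact_UN compact_convex_hull finite_imp_compact) auto

lemma sum_coord_pos: "f \<in> P \<Longrightarrow> 0 < (\<Sum>k\<in>UNIV. coord f k)"
proof -
  assume f: "f \<in> P"
  then obtain i where "i \<in> supp f" using supp_nonempty vw by blast
  then show ?thesis by (intro sum_pos2[of _ i]) (auto simp: coord_pos_iff coord_nonneg)
qed

lemma proj_pos_iff: "f \<in> P \<Longrightarrow> 0 < proj f $ i \<longleftrightarrow> i \<in> supp f"
  using sum_coord_pos[of f] by (simp add: proj_def zero_less_divide_iff coord_pos_iff less_le_not_le[of 0 "sum _ _"])

lemma proj_in: "f \<in> P \<Longrightarrow> proj f \<in> S"
proof -
  assume f: "f \<in> P"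
  have "0 \<le> proj f $ i" for i
    unfolding proj_def using sum_coord_pos[OF f] coord_nonneg by simp
  moreover have "(\<Sum>i\<in>UNIV. proj f $ i) = 1"
    unfolding proj_def using sum_coord_pos[OF f] by (simp flip: sum_divide_distrib)
  moreover have "{i. 0 < proj f $ i} = supp f" using proj_pos_iff[OF f] by blast
  ultimately show ?thesis using supp_in_past_link[OF f vw] by (simp add: mem_S)
qed

lemma continuous_on_proj: "continuous_on P proj"
  unfolding proj_def using sum_coord_pos by (intro continuous_intros) (auto simp: less_le)

text \<open>The map is \<open>proj\<close>. Its inverse \<open>s\<close> sends \<open>z\<close> to
  the outcome of running all faces with their weights at \<open>z\<close>. Some weight is 2, so this
  outcome does not depend on the initial dipath, and \<open>s\<close> can be defined by starting at
  that face.\<close>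

lemma homotopy_eqv_link: "P homotopy_eqv S"
proof -
  obtain as :: "'n set list" where as: "set as = {a. a \<noteq> {}}"
    and sorted: "sorted_wrt (\<lambda>a b. card b \<le> card a) as"
    by (rule exists_decreasing_labels)
  define W where "W = (\<lambda>z a. weight a (z :: real ^ 'n))"
  have adm: "admissible bs (\<lambda>a. r * W z a) f"
    if bs: "bs = drop k as" and r: "0 \<le> r" "r \<le> 1" and f: "f \<in> P"
      and sup: "\<And>a. a \<in> set bs \<Longrightarrow> 0 < W z a \<Longrightarrow> a \<subseteq> supp f" for bs k r z f
    unfolding admissible_def
  proof (intro conjI ballI)
    show "sorted_wrt (\<lambda>a b. 0 < r * W z a \<longrightarrow> 0 < r * W z b \<longrightarrow> b \<subseteq> a) bs"
      using sorted_wrt_drop[OF sorted, of k] unfolding bs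
      by (rule sorted_wrt_mono_rel[rotated])
        (use r in \<open>auto simp: W_def zero_less_mult_iff intro: weight_chain[THEN subsetD]\<close>)
    fix a assume a: "a \<in> set bs"
    then show "a \<noteq> {}" using as bs set_drop_subset by fast
    show "0 \<le> r * W z a" using mult_nonneg_nonneg[OF r(1) weight_bounds(1)] by (simp add: W_def)
    show "r * W z a \<le> 2"  
      using mult_mono[OF r(2) weight_bounds(2)[of a z] zero_le_one weight_bounds(1)[of a z]] by (simp add: W_def)
    show "0 < r * W z a \<longrightarrow> a \<subseteq> supp f" using sup[OF a] r by (auto simp: zero_less_mult_iff)
  qed fact
  \<comment> \<open>The closed set on which the face with index \<open>k\<close> has full weight;
    there the run may start afresh from \<open>q (as ! k)\<close> with the faces that
    follow.\<close>
  define N where "N = (\<lambda>k. {z \<in> S. W z (as ! k) = 2})"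
  define piece where "piece = (\<lambda>k z. runs (drop (Suc k) as) (W z) (q (as ! k)))"
  have split: "as = take k as @ as ! k # drop (Suc k) as" if "k < length as" for k
    using that by (rule id_take_nth_drop)
  have pos_sub: "a \<subseteq> {i. 0 < z $ i}" if "0 < W z a" for a z
    using weight_pos(1) that unfolding W_def by blast
  have N_L: "as ! k \<in> L" if "k < length as" "z \<in> N k" for k z
  proof -
    have "as ! k \<noteq> {}" using as nth_mem[OF that(1)] by blast
    moreover have "{i. 0 < z $ i} \<in> L" using that by (simp add: N_def mem_S)
    moreover have "as ! k \<subseteq> {i. 0 < z $ i}" using pos_sub[of z "as ! k"] that(2) by (simp add: N_def)
    ultimately show ?thesis using past_link_complex_subset by blast
  qed
  \<comment> \<open>Faces after index \<open>k\<close> are not larger, so those of positive weight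
    lie in \<open>as ! k\<close>, which is the support of \<open>q (as ! k)\<close>.\<close>
  have adm_piece: "admissible (drop (Suc k) as) (W z) (q (as ! k))" if k: "k < length as" and z: "z \<in> N k" for k z
  proof -
    have "admissible (drop (Suc k) as) (\<lambda>a. 1 * W z a) (q (as ! k))"
    proof (rule adm[OF refl])
      show "q (as ! k) \<in> P" using N_L[OF k z] by (rule q_in)
      fix a assume a: "a \<in> set (drop (Suc k) as)" "0 < W z a"
      have "card a \<le> card (as ! k)"
        using sorted a(1) unfolding in_set_conv_nth sorted_wrt_iff_nth_less by force
      then have "a \<subseteq> as ! k"
        using weight_chain[of "as ! k" z a] a(2) z by (simp add: W_def N_def)
      then show "a \<subseteq> supp (q (as ! k))" using supp_q[OF N_L[OF k z]] by simp
    qed auto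
    then show ?thesis by simp
  qed
  have piece_in: "piece k z \<in> P" "supp (piece k z) \<subseteq> {i. 0 < z $ i}"
    if k: "k < length as" and z: "z \<in> N k" for k z
  proof -
    note r = runs_props[OF adm_piece[OF k z]]
    show "piece k z \<in> P" unfolding piece_def using r by blast
    have "supp (q (as ! k)) \<subseteq> {i. 0 < z $ i}"
      using supp_q[OF N_L[OF k z]] pos_sub[of z "as ! k"] z by (simp add: N_def)
    then show "supp (piece k z) \<subseteq> {i. 0 < z $ i}"
      unfolding piece_def using r(2) pos_sub by blast
  qed
  have forget: "runs (take k as @ as ! k # drop (Suc k) as) (W z) f = piece k z"
    if "admissible as (W z) f" "k < length as" "z \<in> N k" for k z f
    unfolding piece_def by (rule runs_forget(1)) (use that split in \<open>auto simp: N_def\<close>)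
  \<comment> \<open>The run started at index \<open>k\<close> passes index \<open>l\<close> with
    full weight and is forgotten there, so both runs continue from
    \<open>q (as ! l)\<close>.\<close>
  have agree: "piece k z = piece l z" if "k < l" "l < length as" "z \<in> N k" "z \<in> N l" for k l z
  proof -
    have k: "k < length as" using that by simp
    have d: "drop (Suc k) as = take (l - Suc k) (drop (Suc k) as) @ as ! l # drop (Suc l) as"
      using id_take_nth_drop[of "l - Suc k" "drop (Suc k) as"] that by simp
    have "runs (take (l - Suc k) (drop (Suc k) as) @ as ! l # drop (Suc l) as) (W z) (q (as ! k)) =
        runs (drop (Suc l) as) (W z) (q (as ! l))"
      by (rule runs_forget(1)) (use adm_piece[OF k that(3)] that(4) d in \<open>auto simp: N_def\<close>)
    then show ?thesis unfolding piece_def using d by simp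
  qed
  have cover: "\<exists>k<length as. z \<in> N k" if z: "z \<in> S" for z
  proof -
    obtain a where a: "a \<noteq> {}" "weight a z = 2"
      using exists_weight_2[of z] z by (auto simp: mem_S)
    then have "a \<in> set as" using as by simp
    then obtain k where "k < length as" "as ! k = a" by (auto simp: in_set_conv_nth)
    then show ?thesis using a z by (auto simp: N_def W_def)
  qed
  \<comment> \<open>The least index merely selects one; by \<open>agree\<close> every index with
    \<open>z \<in> N k\<close> gives the same value. The finitely many closed sets
    \<open>N k\<close> then glue to a continuous map.\<close>
  define s where "s = (\<lambda>z. piece (LEAST k. k < length as \<and> z \<in> N k) z)"
  have s_eq: "s z = piece k z" if "k < length as" "z \<in> N k" for k z
  proof -
    let ?l = "LEAST k. k < length as \<and> z \<in> N k"
    have "?l < length as \<and> z \<in> N ?l" by (rule LeastI[of _ k]) (use that in blast)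
    moreover have "?l \<le> k" by (rule Least_le) (use that in blast)
    ultimately show ?thesis
      unfolding s_def using agree[of ?l k z] that by (cases "?l = k") auto
  qed
  have s_in: "s z \<in> P" "supp (s z) \<subseteq> {i. 0 < z $ i}" if z: "z \<in> S" for z
    using cover[OF z] s_eq piece_in by force+
  have s_cont: "continuous_on S s"
  proof -
    have "continuous_on (\<Union>k\<in>{..<length as}. N k) s"
    proof (rule continuous_on_closed_Union)
      fix k assume k: "k \<in> {..<length as}"
      have "closedin (top_of_set S) (N k)"
        unfolding N_def W_def
        by (intro continuous_closedin_preimage_constant continuous_intros)
      then show "closed (N k)"
        using compact_S compact_imp_closed closedin_closed_trans by blast
      have "continuous_on (N k) (piece k)"
        unfolding piece_def
        by (intro continuous_on_runs) (use adm_piece k in \<open>auto simp: W_def intro!: continuous_intros\<close>)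
      then show "continuous_on (N k) s"
        by (rule continuous_on_eq) (use s_eq k in auto)
    qed simp
    moreover have "(\<Union>k\<in>{..<length as}. N k) = S" using cover by (auto simp: N_def)
    ultimately show ?thesis by simp
  qed
  have hom1: "homotopic_with_canon (\<lambda>x. True) P P id (s \<circ> proj)"
  proof -
    \<comment> \<open>All weights are scaled by \<open>r\<close>: for \<open>r = 0\<close> every
      step is the identity, for \<open>r = 1\<close> the run forgets \<open>f\<close>. The weights
      are taken at the position of the initial dipath throughout the run, so the outcome depends on
      \<open>proj f\<close> only.\<close>
    define H where "H = (\<lambda>(r, f). runs as (\<lambda>a. r * W (proj f) a) f)"
    have admH: "admissible as (\<lambda>a. r * W (proj f) a) f" if "f \<in> P" "0 \<le> r" "r \<le> 1" for r f
    proof (rule adm[of as 0])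
      fix a assume "0 < W (proj f) a"
      then show "a \<subseteq> supp f" using pos_sub proj_pos_iff[OF that(1)] by blast
    qed (use that in auto)
    have "continuous_on ({0..1} \<times> P) H"
      unfolding H_def case_prod_unfold
    proof (rule continuous_on_runs)
      have p: "continuous_on ({0..1} \<times> P) (\<lambda>z :: real \<times> _. proj (snd z))"
        by (rule continuous_on_compose2[OF continuous_on_proj continuous_on_snd[OF continuous_on_id]]) auto
      show "continuous_on ({0..1} \<times> P) (\<lambda>z. fst z * W (proj (snd z)) a)" for a
        unfolding W_def by (intro continuous_intros p)
    qed (use admH in \<open>auto intro!: continuous_intros\<close>)
    moreover have "H ` ({0..1} \<times> P) \<subseteq> P"
      unfolding H_def using runs_props(1)[OF admH] by auto
    moreover have "H (0, f) = id f" if "f \<in> P" for f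
      unfolding H_def using runs_0[OF that] by simp
    moreover have "H (1, f) = (s \<circ> proj) f" if f: "f \<in> P" for f
    proof -
      obtain k where k: "k < length as" "proj f \<in> N k" using cover[OF proj_in[OF f]] by blast
      have "runs as (W (proj f)) f = piece k (proj f)"
        using forget[OF _ k, of f] admH[OF f, of 1] split[OF k(1)] by simp
      then show ?thesis using s_eq[OF k] by (simp add: H_def)
    qed
    ultimately show ?thesis
      by (subst homotopic_with, simp, intro exI[of _ H]) (auto simp: image_subset_iff)
  qed
  \<comment> \<open>The support of \<open>s z\<close> is contained in that of \<open>z\<close>, so
    \<open>proj (s z)\<close> and \<open>z\<close> lie in a common simplex and the straight segment
    stays in \<open>S\<close>.\<close>
  have hom2: "homotopic_with_canon (\<lambda>x. True) S S (proj \<circ> s) id"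
  proof (rule homotopic_with_linear)
    have sS: "s ` S \<subseteq> P" using s_in by auto
    show "continuous_on S (proj \<circ> s)"
      by (intro continuous_on_compose s_cont continuous_on_subset[OF continuous_on_proj sS])
    show "continuous_on S id" by (simp add: continuous_on_id')
    fix z assume z: "z \<in> S"
    note sz = s_in[OF z]
    have y: "proj (s z) \<in> S" by (rule proj_in[OF sz(1)])
    show "closed_segment ((proj \<circ> s) z) (id z) \<subseteq> S"
    proof
      fix x assume "x \<in> closed_segment ((proj \<circ> s) z) (id z)"
      then obtain r where r: "0 \<le> r" "r \<le> 1" and x: "x = (1 - r) *\<^sub>R proj (s z) + r *\<^sub>R z"
        by (auto simp: in_segment)
      have nn: "0 \<le> x $ i" for i using y z r by (simp add: x mem_S)
      have s1: "(\<Sum>i\<in>UNIV. x $ i) = 1"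
        using y z by (simp add: x mem_S sum.distrib flip: sum_distrib_left)
      have "{i. 0 < x $ i} \<subseteq> {i. 0 < z $ i}"
      proof
        fix i assume i: "i \<in> {i. 0 < x $ i}"
        show "i \<in> {i. 0 < z $ i}"
        proof (rule ccontr)
          assume "i \<notin> {i. 0 < z $ i}"
          then have "z $ i = 0" "\<not> 0 < proj (s z) $ i"
            using z sz proj_pos_iff[OF sz(1)] by (auto simp: mem_S not_less intro: antisym)
          then have "x $ i \<le> 0" using r by (simp add: x mult_le_0_iff not_less)
          then show False using i by simp
        qed
      qed
      moreover have "{i. 0 < x $ i} \<noteq> {}"
      proof
        assume "{i. 0 < x $ i} = {}"
        then have "(\<Sum>i\<in>UNIV. x $ i) \<le> 0" by (intro sum_nonpos) (auto simp: not_less)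
        then show False using s1 by simp
      qed
      ultimately have "{i. 0 < x $ i} \<in> L"
        using z past_link_complex_subset by (simp add: mem_S) blast
      then show "x \<in> S" using nn s1 by (simp add: mem_S)
    qed
  qed
  show ?thesis
    unfolding homotopy_equivalent_space_def
    by (intro exI[of _ proj] exI[of _ s])
      (use hom1 hom2 proj_in s_in s_cont continuous_on_proj in \<open>auto simp: homotopic_with_sym image_subset_iff\<close>)
qed

end

text \<open>Contractibility at the lower corners provides the contractions that the deformation
  uses. Both nonemptiness and contractibility then pass through
  \<open>homotopy_eqv_link\<close>.\<close>

lemma nonempty_contractible_iff_link:
  assumes "dipath_target K w v" "v \<noteq> w"
    and below: "\<And>a. a \<in> past_link_complex K v \<Longrightarrow>
      nonempty_contractible_space (dipath_space K w (v - ind a))"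
  shows "nonempty_contractible_space (dipath_space K w v) \<longleftrightarrow>
    geometric_realization (past_link_complex K v) \<noteq> {} \<and>
    contractible (geometric_realization (past_link_complex K v))"
proof -
  interpret dipath_target K w v by fact
  let ?L = "past_link_complex K v"
  let ?D = "\<lambda>a. dipath_funs K w (v - ind a)"
  have "\<exists>h p. continuous_on ({0..1::real} \<times> ?D a) h \<and>
      (\<forall>r g. 0 \<le> r \<longrightarrow> r \<le> 1 \<longrightarrow> g \<in> ?D a \<longrightarrow> h (r, g) \<in> ?D a) \<and>
      (\<forall>g\<in>?D a. h (0, g) = g) \<and> (\<forall>g\<in>?D a. h (1, g) = p) \<and> p \<in> ?D a" if "a \<in> ?L" for a
  proof -
    have ne: "?D a \<noteq> {}" and c: "contractible (?D a)"
      using below[OF that] by (auto simp: nonempty_contractible_dipath_space)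
    obtain p where "homotopic_with_canon (\<lambda>x. True) (?D a) (?D a) id (\<lambda>x. p)"
      using c unfolding contractible_def by blast
    then obtain h where h: "continuous_on ({0..1::real} \<times> ?D a) h" "h ` ({0..1} \<times> ?D a) \<subseteq> ?D a"
      "\<forall>g. h (0, g) = g" "\<forall>g. h (1, g) = p"
      unfolding homotopic_with_def by (auto simp: image_subset_iff)
    \<comment> \<open>The definition of \<open>contractible\<close> does not place \<open>p\<close>
      in the set; the end of the track of any point \<open>g\<close> does.\<close>
    obtain g where "g \<in> ?D a" using ne by blast
    then have "h (1, g) \<in> ?D a" using h(2) by (auto simp: image_subset_iff)
    then show ?thesis using h by (intro exI[of _ h] exI[of _ p]) (auto simp: image_subset_iff)
  qed
  then have "\<exists>hp. \<forall>a\<in>?L. continuous_on ({0..1::real} \<times> ?D a) (fst (hp a)) \<and>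
      (\<forall>r g. 0 \<le> r \<longrightarrow> r \<le> 1 \<longrightarrow> g \<in> ?D a \<longrightarrow> fst (hp a) (r, g) \<in> ?D a) \<and>
      (\<forall>g\<in>?D a. fst (hp a) (0, g) = g) \<and> (\<forall>g\<in>?D a. fst (hp a) (1, g) = snd (hp a)) \<and> snd (hp a) \<in> ?D a"
    by (intro bchoice ballI) (metis fst_conv snd_conv)
  then obtain hp where hp: "\<And>a. a \<in> ?L \<Longrightarrow> continuous_on ({0..1::real} \<times> ?D a) (fst (hp a)) \<and>
      (\<forall>r g. 0 \<le> r \<longrightarrow> r \<le> 1 \<longrightarrow> g \<in> ?D a \<longrightarrow> fst (hp a) (r, g) \<in> ?D a) \<and>
      (\<forall>g\<in>?D a. fst (hp a) (0, g) = g) \<and> (\<forall>g\<in>?D a. fst (hp a) (1, g) = snd (hp a)) \<and> snd (hp a) \<in> ?D a"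
    by blast
  interpret dipath_target_contractions K w v "\<lambda>a. fst (hp a)" "\<lambda>a. snd (hp a)"
    by unfold_locales (use hp assms(2) in blast)+
  have eq: "P homotopy_eqv S" by (rule homotopy_eqv_link)
  have "P = {} \<longleftrightarrow> S = {}" using eq homotopy_eqv_empty1 homotopy_eqv_empty2 by metis
  then show ?thesis
    unfolding nonempty_contractible_dipath_space
    using homotopy_eqv_contractibility[OF eq] by blast
qed

section \<open>From single vertices to the whole complex\<close>

lemma dipath_funs_self: "w \<in> K \<Longrightarrow> dipath_funs K w w = {lift01 (\<lambda>t. w)}"
proof
  assume w: "w \<in> K"
  show "{lift01 (\<lambda>t. w)} \<subseteq> dipath_funs K w w"
    using w by (auto intro!: lift01_in_dipath_funs mono_onI)
  show "dipath_funs K w w \<subseteq> {lift01 (\<lambda>t. w)}"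
  proof
    fix f assume f: "f \<in> dipath_funs K w w"
    have "apply_bcontfun f t = w" if "t \<in> {0..1}" for t
    proof -
      have "apply_bcontfun f 0 \<le> apply_bcontfun f t" "apply_bcontfun f t \<le> apply_bcontfun f 1"
        using f that mono_onD[of "{0..1}" "apply_bcontfun f" 0 t]
          mono_onD[of "{0..1}" "apply_bcontfun f" t 1] by (auto simp: dipath_funs_def)
      then show ?thesis using f by (simp add: dipath_funs_def)
    qed
    then have "lift01 (apply_bcontfun f) = lift01 (\<lambda>t. w)" by (intro lift01_cong)
    then show "f \<in> {lift01 (\<lambda>t. w)}" using lift01_apply[OF f] by simp
  qed
qed

text \<open>Lower corners of past-link cubes are again vertices, so
  \<open>nonempty_contractible_iff_link\<close> applies at each vertex. Its premise is part of the
  assumption in one direction and the induction hypothesis in the other; at \<open>w\<close> itself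
  there is only the constant dipath.\<close>

theorem dipath_spaces_contractible_iff_past_links:
  fixes K :: "(real ^ 'n) set"
  assumes cubes: "cube_union K" and w: "minimum_vertex K w"
  shows "(\<forall>v\<in>verts K. nonempty_contractible_space (dipath_space K w v)) \<longleftrightarrow>
    (\<forall>v\<in>verts K - {w}. geometric_realization (past_link_complex K v) \<noteq> {} \<and>
      contractible (geometric_realization (past_link_complex K v)))" (is "?lhs \<longleftrightarrow> ?rhs")
proof -
  have wK: "w \<in> K" "w \<in> int_points" "\<And>x. x \<in> K \<Longrightarrow> w \<le> x"
    using w by (auto simp: minimum_vertex_def verts_def)
  have target: "dipath_target K w v" if "v \<in> verts K" for v
    by unfold_locales (use that cubes wK in \<open>auto simp: verts_def\<close>)
  have below: "v - ind a \<in> verts K" if "v \<in> verts K" "a \<in> past_link_complex K v" for v a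
  proof -
    have "v - ind a \<in> {v - ind a..v}" by (simp add: less_eq_vec_def)
    then show ?thesis using that int_points_diff ind_in_int_points
      unfolding verts_def mem_past_link_complex by blast
  qed
  show ?thesis
  proof
    assume ?lhs
    then show ?rhs using nonempty_contractible_iff_link[OF target] below by blast
  next
    assume R: ?rhs
    show ?lhs
    proof
      fix v assume "v \<in> verts K"
      then show "nonempty_contractible_space (dipath_space K w v)"
      \<comment> \<open>The measure is the 1-norm distance from \<open>w\<close>. It drops by
        \<open>card a \<ge> 1\<close>, and minimality of \<open>w\<close> keeps it nonnegative, so
        truncation to a natural number preserves the strict decrease.\<close>
      proof (induction "nat \<lfloor>\<Sum>i\<in>UNIV. v $ i - w $ i\<rfloor>" arbitrary: v rule: less_induct)
        case less
        show ?case
        proof (cases "v = w")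
          case True
          then show ?thesis using wK by (simp add: nonempty_contractible_dipath_space dipath_funs_self)
        next
          case False
          have "nonempty_contractible_space (dipath_space K w (v - ind a))"
            if a: "a \<in> past_link_complex K v" for a
          proof (rule less.hyps)
            show va: "v - ind a \<in> verts K" by (rule below[OF less.prems a])
            have "w \<le> v - ind a" using va wK by (simp add: verts_def)
            then have "0 \<le> (\<Sum>i\<in>UNIV. (v - ind a) $ i - w $ i)"
              by (intro sum_nonneg) (simp add: less_eq_vec_def)
            moreover have "(\<Sum>i\<in>UNIV. (v - ind a) $ i - w $ i) = (\<Sum>i\<in>UNIV. v $ i - w $ i) - (\<Sum>i\<in>UNIV. ind a $ i)"
              by (simp add: sum_subtractf)
            moreover have "(\<Sum>i\<in>UNIV. ind a $ i) = real (card a)" by (simp add: sum.If_cases)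
            moreover have "1 \<le> card a"
              using a by (simp add: mem_past_link_complex Suc_le_eq card_gt_0_iff)
            ultimately show "nat \<lfloor>\<Sum>i\<in>UNIV. (v - ind a) $ i - w $ i\<rfloor> < nat \<lfloor>\<Sum>i\<in>UNIV. v $ i - w $ i\<rfloor>"
              by linarith
          qed
          then show ?thesis
            using nonempty_contractible_iff_link[OF target[OF less.prems] False] R less.prems False by blast
        qed
      qed
    qed
  qed
qed

subsection \<open>Collapses\<close>

text \<open>A point is relatively interior when every segment of the box that ends in it can be
  prolonged a little. Testing the corners \<open>p\<close> and \<open>q\<close> gives the strict
  inequalities. Conversely each coordinate tolerates a small overshoot, and finitely many
  coordinates tolerate a common one.\<close>

lemma rel_interior_Icc_vec:
  fixes p q :: "real ^ 'n"
  assumes "p \<le> q"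
  shows "x \<in> rel_interior {p..q} \<longleftrightarrow>
    (\<forall>i. p $ i < x $ i \<and> x $ i < q $ i \<or> p $ i = x $ i \<and> x $ i = q $ i)"
proof -
  have pq: "p $ i \<le> q $ i" for i using assms by (simp add: less_eq_vec_def)
  have cv: "convex {p..q}" "{p..q} \<noteq> {}"
    using assms by (simp_all only: interval_cbox convex_box, auto simp: interval_cbox[symmetric])
  show ?thesis
    unfolding convex_rel_interior_iff[OF cv]
  proof (intro iffI allI ballI disjCI conjI)
    fix i
    assume R: "\<forall>y\<in>{p..q}. \<exists>e>1. (1 - e) *\<^sub>R y + e *\<^sub>R x \<in> {p..q}"
      and ne: "\<not> (p $ i = x $ i \<and> x $ i = q $ i)"
    obtain e where e: "e > 1" "(1 - e) *\<^sub>R p + e *\<^sub>R x \<in> {p..q}" using R assms by force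
    obtain d where d: "d > 1" "(1 - d) *\<^sub>R q + d *\<^sub>R x \<in> {p..q}" using R assms by force
    have e1: "(e - 1) * (x $ i - p $ i) + x $ i \<le> q $ i" "0 \<le> e * (x $ i - p $ i)"
      using e(2)[unfolded mem_Icc_vec, rule_format, of i] by (auto simp: algebra_simps)
    have d1: "p $ i \<le> x $ i - (d - 1) * (q $ i - x $ i)" "0 \<le> d * (q $ i - x $ i)"
      using d(2)[unfolded mem_Icc_vec, rule_format, of i] by (auto simp: algebra_simps)
    have px: "p $ i \<le> x $ i" "x $ i \<le> q $ i"
      using e1(2) d1(2) e(1) d(1) by (auto simp: zero_le_mult_iff)
    show "p $ i < x $ i"
    proof (rule ccontr)
      assume "\<not> p $ i < x $ i"
      then have "0 < (d - 1) * (q $ i - x $ i)" using px ne d(1) by (intro mult_pos_pos) auto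
      then show False using d1(1) px \<open>\<not> p $ i < x $ i\<close> by linarith
    qed
    show "x $ i < q $ i"
    proof (rule ccontr)
      assume "\<not> x $ i < q $ i"
      then have "0 < (e - 1) * (x $ i - p $ i)" using px ne e(1) by (intro mult_pos_pos) auto
      then show False using e1(1) px \<open>\<not> x $ i < q $ i\<close> by linarith
    qed
  next
    fix y assume R: "\<forall>i. p $ i < x $ i \<and> x $ i < q $ i \<or> p $ i = x $ i \<and> x $ i = q $ i"
      and y: "y \<in> {p..q}"
    have "\<forall>\<^sub>F d in at_right 0. p $ i \<le> x $ i + d * (x $ i - y $ i) \<and> x $ i + d * (x $ i - y $ i) \<le> q $ i" for i
    proof (cases "p $ i = x $ i \<and> x $ i = q $ i")
      case True
      then have "y $ i = x $ i" using y[unfolded mem_Icc_vec, rule_format, of i] by simp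
      then show ?thesis using True by simp
    next
      case False
      then have i: "p $ i < x $ i" "x $ i < q $ i" using R by blast+
      have t: "((\<lambda>d. x $ i + d * (x $ i - y $ i)) \<longlongrightarrow> x $ i + 0 * (x $ i - y $ i)) (at_right 0)"
        by (intro tendsto_intros)
      have "\<forall>\<^sub>F d in at_right 0. p $ i < x $ i + d * (x $ i - y $ i)"
        "\<forall>\<^sub>F d in at_right 0. x $ i + d * (x $ i - y $ i) < q $ i"
        using order_tendstoD[OF t] i by auto
      then show ?thesis by eventually_elim simp
    qed
    then have "\<forall>\<^sub>F d in at_right 0. \<forall>i. p $ i \<le> x $ i + d * (x $ i - y $ i) \<and> x $ i + d * (x $ i - y $ i) \<le> q $ i"
      by (rule eventually_all_finite)
    moreover have "\<forall>\<^sub>F d in at_right 0. (0::real) < d" by (rule eventually_at_right_less)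
    ultimately have "\<forall>\<^sub>F d in at_right (0::real). 0 < d \<and> (\<forall>i. p $ i \<le> x $ i + d * (x $ i - y $ i) \<and>
        x $ i + d * (x $ i - y $ i) \<le> q $ i)" by eventually_elim simp
    then obtain d :: real where d: "0 < d" "\<forall>i. p $ i \<le> x $ i + d * (x $ i - y $ i) \<and>
        x $ i + d * (x $ i - y $ i) \<le> q $ i"
      using eventually_happens trivial_limit_at_right_real by blast
    have "(1 - (1 + d)) *\<^sub>R y + (1 + d) *\<^sub>R x \<in> {p..q}"
      unfolding mem_Icc_vec using d(2) by (simp add: algebra_simps)
    then show "\<exists>e>1. (1 - e) *\<^sub>R y + e *\<^sub>R x \<in> {p..q}" using d(1) by (intro exI[of _ "1 + d"]) auto
  qed
qed

section \<open>Open lattice cubes and carriers\<close>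

abbreviation cube :: "real ^ 'n \<Rightarrow> 'n set \<Rightarrow> (real ^ 'n) set"
  where "cube u a \<equiv> {u - ind a..u}"

lemma ind_diff_le: "u - ind a \<le> u"
  by (simp add: less_eq_vec_def)

lemma min_corner: "u - ind a \<in> cube u a"
  by (simp add: ind_diff_le)

lemma mem_rel_interior_cube:
  "x \<in> rel_interior (cube u a) \<longleftrightarrow>
    (\<forall>i. if i \<in> a then u $ i - 1 < x $ i \<and> x $ i < u $ i else x $ i = u $ i)"
proof -
  have "(u - ind a) $ i < x $ i \<and> x $ i < u $ i \<or> (u - ind a) $ i = x $ i \<and> x $ i = u $ i \<longleftrightarrow>
    (if i \<in> a then u $ i - 1 < x $ i \<and> x $ i < u $ i else x $ i = u $ i)" for i
    by (cases "i \<in> a") auto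
  then show ?thesis unfolding rel_interior_Icc_vec[OF ind_diff_le] by simp
qed

lemma closure_rel_interior_cube [simp]: "closure (rel_interior (cube u a)) = cube u a"
proof -
  have "convex (cube u a)" "closed (cube u a)" by (simp_all add: interval_cbox closed_cbox)
  then show ?thesis by (simp add: convex_closure_rel_interior)
qed

lemma strata_iff:
  "\<gamma> \<in> strata K \<longleftrightarrow> (\<exists>u a. u \<in> int_points \<and> cube u a \<subseteq> K \<and> \<gamma> = rel_interior (cube u a))"
  unfolding strata_def elementary_cubes_eq by auto

lemma cubical_complex_imp_cube_union: "cubical_complex K \<Longrightarrow> cube_union K"
  unfolding cubical_complex_def cube_union_def elementary_cubes_eq by blast

text \<open>No integer lies strictly inside a unit interval with integral ends, so an integral box
  that meets the open cube contains all of it.\<close>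

lemma cube_subset_Icc:
  assumes x: "x \<in> rel_interior (cube u a)" "x \<in> {p..q}"
    and int: "u \<in> int_points" "p \<in> int_points" "q \<in> int_points"
  shows "cube u a \<subseteq> {p..q}"
proof -
  have "p $ i \<le> (u - ind a) $ i \<and> u $ i \<le> q $ i" for i
  proof -
    have xi: "p $ i \<le> x $ i" "x $ i \<le> q $ i" using x(2) unfolding mem_Icc_vec by auto
    have I: "u $ i \<in> \<int>" "p $ i \<in> \<int>" "q $ i \<in> \<int>" "u $ i - 1 \<in> \<int>" using int by (auto simp: int_points_def)
    show ?thesis
    proof (cases "i \<in> a")
      case True
      then have "u $ i - 1 < x $ i" "x $ i < u $ i" using x(1) unfolding mem_rel_interior_cube by metis+
      then show ?thesis
        using Ints_less_imp[OF I(2,1)] Ints_less_imp[OF I(4,3)] True xi by simp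
    next
      case False
      then have "x $ i = u $ i" using x(1) unfolding mem_rel_interior_cube by metis
      then show ?thesis using xi False by simp
    qed
  qed
  then show ?thesis unfolding subset_iff mem_Icc_vec by (meson order_trans)
qed

text \<open>Rounding up gives the upper corner, and the nonintegral coordinates give the directions.
  This cube lies in every closed lattice cube through \<open>x\<close>, in particular in one
  contained in \<open>K\<close>.\<close>

lemma carrier_cube:
  assumes "cube_union K" "x \<in> K"
  obtains u a where "u \<in> int_points" "x \<in> rel_interior (cube u a)" "cube u a \<subseteq> K"
proof -
  obtain c b where c: "c \<in> int_points" "x \<in> cube c b" "cube c b \<subseteq> K"
    using assms unfolding cube_union_def by blast
  define u :: "real ^ 'a" where "u = (\<chi> i. of_int \<lceil>x $ i\<rceil>)"
  define a where "a = {i. x $ i \<notin> \<int>}"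
  have u: "u \<in> int_points" by (simp add: u_def int_points_def)
  have "if i \<in> a then u $ i - 1 < x $ i \<and> x $ i < u $ i else x $ i = u $ i" for i
  proof (cases "i \<in> a")
    case True
    then have "x $ i \<noteq> u $ i" unfolding a_def u_def by (auto simp: Ints_def)
    moreover have "u $ i - 1 < x $ i" "x $ i \<le> u $ i" unfolding u_def by (simp_all, linarith+)
    ultimately show ?thesis using True by simp
  next
    case False
    then show ?thesis unfolding a_def u_def by (auto elim!: Ints_cases)
  qed
  then have x: "x \<in> rel_interior (cube u a)" unfolding mem_rel_interior_cube by blast
  have "cube u a \<subseteq> cube c b"
    by (rule cube_subset_Icc[OF x c(2) u]) (use c int_points_diff ind_in_int_points in auto)
  then show ?thesis using that[OF u x] c(3) by blast
qed

text \<open>Among the cubes of \<open>K\<close> containing the given one, take one of largest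
  dimension. A coface of it has no further directions, and then inclusion forces equal
  corners.\<close>

lemma cube_subset_maximal:
  assumes u: "u \<in> int_points" "cube u a \<subseteq> K"
  obtains \<rho> where "maximal_cube K \<rho>" "cube u a \<subseteq> closure \<rho>"
proof -
  define Q where "Q = (\<lambda>(u', a'). u' \<in> int_points \<and> cube u a \<subseteq> cube u' a' \<and> cube u' a' \<subseteq> K)"
  have "Q (u, a)" using u by (simp add: Q_def)
  moreover have "\<forall>y. Q y \<longrightarrow> card (snd y) < Suc CARD('a)"
    by (simp add: less_Suc_eq_le card_mono)
  ultimately have "\<exists>y. Q y \<and> (\<forall>z. Q z \<longrightarrow> card (snd z) \<le> card (snd y))"
    by (rule ex_has_greatest_nat)
  then obtain u' a' where Q: "Q (u', a')" and max: "\<And>z. Q z \<Longrightarrow> card (snd z) \<le> card a'"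
    by auto
  have "maximal_cube K (rel_interior (cube u' a'))"
    unfolding maximal_cube_def
  proof (intro conjI notI)
    show "rel_interior (cube u' a') \<in> strata K" using Q by (auto simp: Q_def strata_iff)
    assume "\<exists>\<rho>\<in>strata K. closure (rel_interior (cube u' a')) \<subset> closure \<rho>"
    then obtain \<rho> where "\<rho> \<in> strata K" "cube u' a' \<subset> closure \<rho>"
      unfolding closure_rel_interior_cube by blast
    then obtain x b where x: "x \<in> int_points" "cube x b \<subseteq> K" "cube u' a' \<subset> cube x b"
      unfolding strata_iff by (metis closure_rel_interior_cube)
    have "u' \<in> cube u' a'" "u' - ind a' \<in> cube u' a'" by (simp_all add: ind_diff_le)
    then have "u' \<in> cube x b" "u' - ind a' \<in> cube x b" using x(3) by blast+
    then have le: "u' $ i \<le> x $ i" "x $ i - ind b $ i \<le> u' $ i - ind a' $ i" for i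
      unfolding mem_Icc_vec by auto
    have sub: "a' \<subseteq> b"
    proof
      fix i assume "i \<in> a'"
      then show "i \<in> b" using le[of i] by (auto split: if_splits)
    qed
    have "Q (x, b)" using Q x unfolding Q_def by blast
    then have "card b \<le> card a'" using max by fastforce
    then have "a' = b" using sub by (simp add: card_seteq)
    then have "x $ i = u' $ i" for i using le[of i] by simp
    then have "x = u'" by (simp add: vec_eq_iff)
    then show False using x(3) \<open>a' = b\<close> by blast
  qed
  then show ?thesis using that[of "rel_interior (cube u' a')"] Q by (simp add: Q_def)
qed

section \<open>Cubes, vertices and past links under a collapse\<close>

locale free_collapse =
  fixes K :: "(real ^ 'n) set" and \<tau> \<sigma> t b s c
  assumes cubes: "cube_union K" and free: "free_face K \<tau> \<sigma>"
    and \<tau>: "\<tau> = rel_interior (cube t b)" "t \<in> int_points"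
    and \<sigma>: "\<sigma> = rel_interior (cube s c)" "s \<in> int_points"
begin

abbreviation "K' \<equiv> collapse K \<tau> \<sigma>"

lemma sub: "cube t b \<subset> cube s c" "cube s c \<subseteq> K"
proof -
  show "cube t b \<subset> cube s c" using free by (simp add: free_face_def \<tau> \<sigma>)
  have "\<sigma> \<in> strata K" using free by (simp add: free_face_def maximal_cube_def)
  then obtain u a where "cube u a \<subseteq> K" "\<sigma> = rel_interior (cube u a)" by (auto simp: strata_iff)
  then show "cube s c \<subseteq> K" using \<sigma>(1) closure_rel_interior_cube by metis
qed

text \<open>The cube lies in some maximal cube, which also contains \<open>\<tau>\<close> and hence
  is \<open>\<sigma>\<close> by freeness.\<close>

lemma free_cube:
  assumes "u \<in> int_points" "cube u a \<subseteq> K" "cube t b \<subseteq> cube u a"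
  shows "cube u a \<subseteq> cube s c"
proof -
  obtain \<rho> where \<rho>: "maximal_cube K \<rho>" "cube u a \<subseteq> closure \<rho>"
    using cube_subset_maximal assms by blast
  moreover have "closure \<tau> \<subseteq> closure \<rho>" 
    unfolding \<tau> closure_rel_interior_cube using \<rho>(2) assms(3) by blast
  ultimately have "\<rho> = \<sigma>" using free unfolding free_face_def by blast
  then show ?thesis using \<rho> by (simp add: \<sigma>)
qed

text \<open>If the carrier of \<open>x\<close> contains \<open>\<tau>\<close>, it lies in
  \<open>\<sigma>\<close> by freeness and is removed. Conversely the closure of any stratum through
  \<open>x\<close> lies in the carrier, so a removed stratum puts \<open>\<tau>\<close> into the
  carrier.\<close>

lemma mem_collapse_iff:
  assumes u: "u \<in> int_points" "cube u a \<subseteq> K" "x \<in> rel_interior (cube u a)"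
  shows "x \<in> K' \<longleftrightarrow> \<not> cube t b \<subseteq> cube u a"
proof
  assume x: "x \<in> K'"
  show "\<not> cube t b \<subseteq> cube u a"
  proof
    assume T: "cube t b \<subseteq> cube u a"
    have "rel_interior (cube u a) \<in> strata K" using u by (auto simp: strata_iff)
    moreover have "closure \<tau> \<subseteq> closure (rel_interior (cube u a))"
      "closure (rel_interior (cube u a)) \<subseteq> closure \<sigma>"
      using T free_cube[OF u(1,2) T] by (simp_all add: \<tau> \<sigma>)
    ultimately show False using x u(3) unfolding collapse_def by blast
  qed
next
  assume T: "\<not> cube t b \<subseteq> cube u a"
  have "x \<in> K" using u rel_interior_subset by blast
  moreover have False if \<gamma>: "\<gamma> \<in> strata K" "closure \<tau> \<subseteq> closure \<gamma>" "x \<in> \<gamma>" for \<gamma>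
  proof -
    obtain y d where y: "y \<in> int_points" "cube y d \<subseteq> K" "\<gamma> = rel_interior (cube y d)"
      using \<gamma>(1) by (auto simp: strata_iff)
    have "x \<in> cube u a" using u(3) rel_interior_subset by blast
    then have "cube y d \<subseteq> cube u a"
      using \<gamma>(3) y u(1) by (intro cube_subset_Icc[of x]) (auto intro: int_points_diff ind_in_int_points)
    then show False using \<gamma>(2) T unfolding y(3) \<tau> closure_rel_interior_cube by blast
  qed
  ultimately show "x \<in> K'" unfolding collapse_def by blast
qed

lemma cube_subset_collapse_iff:
  assumes u: "u \<in> int_points"
  shows "cube u a \<subseteq> K' \<longleftrightarrow> cube u a \<subseteq> K \<and> \<not> cube t b \<subseteq> cube u a"
proof (intro iffI conjI)
  assume sub': "cube u a \<subseteq> K'"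
  then show K: "cube u a \<subseteq> K" by (auto simp: collapse_def)
  \<comment> \<open>The centre of the cube has the whole cube as its carrier, so it decides whether
    the cube survives.\<close>
  have "u - (1/2) *\<^sub>R ind a \<in> rel_interior (cube u a)" by (simp add: mem_rel_interior_cube)
  moreover from this have "u - (1/2) *\<^sub>R ind a \<in> K'" using sub' rel_interior_subset by blast
  ultimately show "\<not> cube t b \<subseteq> cube u a" using mem_collapse_iff[OF u K] by blast
next
  assume R: "cube u a \<subseteq> K \<and> \<not> cube t b \<subseteq> cube u a"
  show "cube u a \<subseteq> K'"
  proof
    fix x assume x: "x \<in> cube u a"
    then obtain y d where y: "y \<in> int_points" "x \<in> rel_interior (cube y d)" "cube y d \<subseteq> K"
      using carrier_cube[OF cubes] R by blast
    have "cube y d \<subseteq> cube u a"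
      using y u x by (intro cube_subset_Icc[of x]) (auto intro: int_points_diff ind_in_int_points)
    then show "x \<in> K'" using mem_collapse_iff[OF y(1,3,2)] R by blast
  qed
qed

lemma cube_union_collapse: "cube_union K'"
  unfolding cube_union_def
proof
  fix x assume x: "x \<in> K'"
  then have "x \<in> K" by (simp add: collapse_def)
  then obtain y d where y: "y \<in> int_points" "x \<in> rel_interior (cube y d)" "cube y d \<subseteq> K"
    using carrier_cube[OF cubes] by blast
  have "cube y d \<subseteq> K'"
    using mem_collapse_iff[OF y(1,3,2)] cube_subset_collapse_iff[OF y(1)] x y(3) by blast
  then show "\<exists>u a. u \<in> int_points \<and> x \<in> cube u a \<and> cube u a \<subseteq> K'"
    using y rel_interior_subset by blast
qed

lemma cube_empty: "cube v {} = {v}"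
  by (simp add: ind_eq_0_iff)

lemma verts_collapse_iff: "v \<in> verts K' \<longleftrightarrow> v \<in> verts K \<and> cube t b \<noteq> {v}"
proof -
  have "cube t b \<noteq> {}" by (simp add: ind_diff_le)
  then have "v \<in> K' \<longleftrightarrow> v \<in> K \<and> cube t b \<noteq> {v}" if "v \<in> int_points"
    using cube_subset_collapse_iff[OF that, of "{}"] unfolding cube_empty by blast
  then show ?thesis unfolding verts_def by blast
qed

lemma past_link_collapse_iff:
  assumes "v \<in> int_points"
  shows "a \<in> past_link_complex K' v \<longleftrightarrow> a \<in> past_link_complex K v \<and> \<not> cube t b \<subseteq> cube v a"
  using cube_subset_collapse_iff[OF assms] by (auto simp: mem_past_link_complex)

text \<open>By freeness every cube of \<open>K\<close> with upper corner \<open>v\<close> lies in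
  \<open>\<sigma>\<close>. Hence the link is the full simplex on the directions in which
  \<open>v\<close> exceeds the lower corner of \<open>\<sigma>\<close>; there is one since
  \<open>v\<close> is not that corner.\<close>

lemma removed_vertex_link:
  assumes v: "v \<in> int_points" "cube t b = {v}" "v \<noteq> s - ind c"
  shows "geometric_realization (past_link_complex K v) \<noteq> {}"
    "contractible (geometric_realization (past_link_complex K v))"
proof -
  have vs: "(s - ind c) $ i \<le> v $ i" "v $ i \<le> s $ i" for i
  proof -
    have "v \<in> cube s c" using sub(1) v(2) by blast
    then show "(s - ind c) $ i \<le> v $ i" "v $ i \<le> s $ i" unfolding mem_Icc_vec by blast+
  qed
  define d where "d = {i. (s - ind c) $ i < v $ i}"
  have "d \<noteq> {}"
  proof
    assume "d = {}"
    then have "\<not> (s - ind c) $ i < v $ i" for i unfolding d_def by blast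
    then have "(s - ind c) $ i = v $ i" for i using vs(1)[of i] by (meson antisym not_less)
    then show False using v(3) by (simp add: vec_eq_iff)
  qed
  have "a \<in> past_link_complex K v \<longleftrightarrow> a \<noteq> {} \<and> a \<subseteq> d" for a
  proof
    assume a: "a \<in> past_link_complex K v"
    then have "cube v a \<subseteq> cube s c"
      by (intro free_cube[OF v(1)]) (auto simp: mem_past_link_complex v(2) ind_diff_le)
    then have "v - ind a \<in> cube s c" using min_corner by blast
    then have le: "(s - ind c) $ i \<le> (v - ind a) $ i" for i unfolding mem_Icc_vec by blast
    have "a \<subseteq> d"
    proof
      fix i assume "i \<in> a"
      then have "(s - ind c) $ i \<le> v $ i - 1" using le[of i] by simp
      then have "(s - ind c) $ i < v $ i" by linarith
      then show "i \<in> d" unfolding d_def by blast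
    qed
    then show "a \<noteq> {} \<and> a \<subseteq> d" using a by (simp add: mem_past_link_complex)
  next
    assume a: "a \<noteq> {} \<and> a \<subseteq> d"
    have "(s - ind c) $ i \<le> (v - ind a) $ i" for i
    proof (cases "i \<in> a")
      case True
      then have "(s - ind c) $ i < v $ i" using a by (auto simp: d_def)
      moreover have "(s - ind c) $ i \<in> \<int>" "v $ i \<in> \<int>" using v(1) \<sigma>(2) by (auto simp: int_points_def)
      ultimately show ?thesis using Ints_less_imp[of "(s - ind c) $ i" "v $ i"] True by simp
    qed (use vs in simp)
    then have "cube v a \<subseteq> cube s c"
      using vs(2) unfolding subset_iff mem_Icc_vec by (meson order_trans)
    then show "a \<in> past_link_complex K v" using a sub(2) unfolding mem_past_link_complex by blast
  qed
  then have L: "past_link_complex K v = {a. a \<noteq> {} \<and> a \<subseteq> d}" by blast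
  have "geometric_realization (past_link_complex K v) = convex hull ((\<lambda>i. axis i 1) ` d)"
    unfolding geometric_realization_def L
  proof
    show "(\<Union>S\<in>{a. a \<noteq> {} \<and> a \<subseteq> d}. convex hull (\<lambda>i. axis i 1) ` S) \<subseteq> convex hull (\<lambda>i. axis i 1) ` d"
      by (intro UN_least hull_mono image_mono) simp
    show "convex hull (\<lambda>i. axis i 1) ` d \<subseteq> (\<Union>S\<in>{a. a \<noteq> {} \<and> a \<subseteq> d}. convex hull (\<lambda>i. axis i 1) ` S)"
      by (rule UN_upper) (use \<open>d \<noteq> {}\<close> in simp)
  qed
  then show "geometric_realization (past_link_complex K v) \<noteq> {}"
    "contractible (geometric_realization (past_link_complex K v))"
    using \<open>d \<noteq> {}\<close> by (auto intro: convex_imp_contractible)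
qed

text \<open>
  In the past link of \<open>v'\<close>, the neighbour of \<open>v\<close> in a direction of \<open>\<sigma>\<close>, the collapse
  deletes an isolated point.
\<close>

lemma removed_min_vertex:
  assumes v: "v \<in> int_points" "cube t b = {v}" "v = s - ind c"
  obtains v' where "v' \<in> verts K'" "v \<le> v'" "v \<noteq> v'"
    "geometric_realization (past_link_complex K' v') \<noteq> {} \<Longrightarrow>
      \<not> contractible (geometric_realization (past_link_complex K v'))"
proof -
  have "c \<noteq> {}"
  proof
    assume "c = {}"
    then have "cube s c = {s}" "v = s" using cube_empty v(3) by (simp_all add: ind_eq_0_iff)
    then show False using sub(1) v(2) by blast
  qed
  then obtain i where i: "i \<in> c" by blast
  define v' where "v' = v + ind {i}"
  have v'_int: "v' \<in> int_points" unfolding v'_def by (intro int_points_add v ind_in_int_points)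
  have "(s - ind c) $ k \<le> v' $ k \<and> v' $ k \<le> s $ k" for k
    using i by (auto simp: v'_def v)
  then have "v' \<in> cube s c" unfolding mem_Icc_vec by blast
  then have v'K: "v' \<in> verts K" using sub v'_int by (auto simp: verts_def)
  have ne: "v \<noteq> v'" by (auto simp: v'_def vec_eq_iff)
  then have 1: "v' \<in> verts K'" using v'K v(2) by (simp add: verts_collapse_iff)
  let ?S = "geometric_realization (past_link_complex K v')"
  let ?S' = "geometric_realization (past_link_complex K' v')"
  \<comment> \<open>A cube below \<open>v'\<close> that extends in direction \<open>i\<close>
    contains \<open>v\<close>, so it lies in \<open>\<sigma>\<close> by freeness. As
    \<open>v\<close> is the lower corner of \<open>\<sigma>\<close>, no other direction is
    available.\<close>
  have iL: "a = {i}" if "a \<in> past_link_complex K v'" "i \<in> a" for a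
  proof -
    have "v \<in> cube v' a" unfolding mem_Icc_vec using that(2) by (auto simp: v'_def)
    then have "cube v' a \<subseteq> cube s c"
      using that by (intro free_cube v'_int) (auto simp: mem_past_link_complex v(2))
    then have "v' - ind a \<in> cube s c" using min_corner by blast
    then have le: "v $ k \<le> (v' - ind a) $ k" for k unfolding mem_Icc_vec v(3) by blast
    have "k = i" if "k \<in> a" for k
      using le[of k] that by (simp add: v'_def split: if_splits)
    then show ?thesis using that(2) by blast
  qed
  have "{i} \<in> past_link_complex K v'"
  proof -
    have "v' - ind {i} = v" by (simp add: v'_def)
    moreover have "{v..v'} \<subseteq> K"
      using \<open>v' \<in> cube s c\<close> sub(2) by (force simp: v(3) intro: order_trans)
    ultimately show ?thesis unfolding mem_past_link_complex by simp
  qed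
  then have ax: "axis i 1 \<in> ?S"
    unfolding geometric_realization_def by (intro UN_I hull_inc) auto
  \<comment> \<open>By \<open>iL\<close> the barycentric coordinate of \<open>i\<close> takes only
    the values 0 and 1 on the link. A simplex that survives the collapse attains 0 and the vertex
    \<open>i\<close> attains 1, so the link is disconnected.\<close>
  have coord: "z $ i = 0 \<or> z $ i = 1" if z: "z \<in> ?S" for z
  proof (cases "z $ i = 0")
    case False
    have zs: "\<forall>k. 0 \<le> z $ k" "(\<Sum>k\<in>UNIV. z $ k) = 1" "{k. 0 < z $ k} \<in> past_link_complex K v'"
      using z by (auto simp: geometric_realization_past_link)
    have "{k. 0 < z $ k} = {i}" by (rule iL[OF zs(3)]) (use False zs(1) in \<open>auto simp: less_le\<close>)
    then have "z $ k = 0" if "k \<noteq> i" for k using that zs(1) by (metis (mono_tags, lifting) less_eq_real_def mem_Collect_eq singletonD)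
    then have "(\<Sum>k\<in>UNIV. z $ k) = (\<Sum>k\<in>{i}. z $ k)" by (intro sum.mono_neutral_right) auto
    then show ?thesis using zs(2) by simp
  qed simp
  have "\<not> contractible ?S" if ne': "?S' \<noteq> {}"
  proof
    assume "contractible ?S"
    then have conn: "connected ((\<lambda>z. z $ i) ` ?S)"
      by (intro connected_continuous_image contractible_imp_connected continuous_intros)
    obtain z where z: "z \<in> ?S'" using ne' by blast
    then have zL: "{k. 0 < z $ k} \<in> past_link_complex K' v'" "\<forall>k. 0 \<le> z $ k" "(\<Sum>k\<in>UNIV. z $ k) = 1"
      by (auto simp: geometric_realization_past_link)
    have zK: "{k. 0 < z $ k} \<in> past_link_complex K v'"
      and nT: "\<not> cube t b \<subseteq> cube v' {k. 0 < z $ k}"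
      using zL(1) past_link_collapse_iff[OF v'_int] by auto
    have "i \<notin> {k. 0 < z $ k}"
    proof
      assume "i \<in> {k. 0 < z $ k}"
      then have eq: "{k. 0 < z $ k} = {i}" using iL[OF zK] by blast
      have "v \<in> cube v' {i}"
        using min_corner[of v' "{i}"] by (simp only: v'_def add_diff_cancel_right')
      then show False using nT unfolding v(2) eq by blast
    qed
    then have "z $ i = 0" using zL(2) by (auto simp: not_less intro: antisym)
    moreover have "z \<in> ?S" using zK zL by (simp add: geometric_realization_past_link)
    ultimately have "0 \<in> (\<lambda>z. z $ i) ` ?S" by force
    moreover have "1 \<in> (\<lambda>z. z $ i) ` ?S" using ax by (force simp: axis_def)
    ultimately have "{0..1} \<subseteq> (\<lambda>z. z $ i) ` ?S"
      using conn connected_contains_Icc by blast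
    then have "1/2 \<in> (\<lambda>z. z $ i) ` ?S" by (auto simp: subset_iff)
    then show False using coord by force
  qed
  moreover have "v \<le> v'" by (simp add: v'_def less_eq_vec_def)
  ultimately show ?thesis using that 1 ne by blast
qed

end

section \<open>Invariance under a link-preserving collapse\<close>

theorem corollary2:
  fixes K K' \<tau> \<sigma> :: "(real ^ 'n) set" and w :: "real ^ 'n"
  assumes "cubical_complex K"
    and "minimum_vertex K w"
    and "\<tau> \<in> strata K" and "\<sigma> \<in> strata K"
    and "free_face K \<tau> \<sigma>"
    and "K' = collapse K \<tau> \<sigma>"
    and "LPDC K K'"
  shows "(\<forall>v\<in>verts K. nonempty_contractible_space (dipath_space K w v)) \<longleftrightarrow>
         (\<forall>k\<in>verts K'. nonempty_contractible_space (dipath_space K' w k))"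
proof -
  obtain t b where t: "t \<in> int_points" "\<tau> = rel_interior (cube t b)"
    using assms(3) by (auto simp: strata_iff)
  obtain s c where s: "s \<in> int_points" "\<sigma> = rel_interior (cube s c)"
    using assms(4) by (auto simp: strata_iff)
  interpret free_collapse K \<tau> \<sigma> t b s c
    by unfold_locales (use assms(1,5) t s cubical_complex_imp_cube_union in auto)
  note K' = assms(6)
  define good where "good = (\<lambda>J v. geometric_realization (past_link_complex J v) \<noteq> {} \<and>
    contractible (geometric_realization (past_link_complex J v :: 'n set set)))"
  \<comment> \<open>Homotopy equivalence also respects emptiness, so \<open>good\<close> transfers
    in both directions.\<close>
  have same: "good K v \<longleftrightarrow> good K' v" if "v \<in> verts K'" for v
  proof -
    have "geometric_realization (past_link_complex K v) homotopy_eqv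
        geometric_realization (past_link_complex K' v)"
      using assms(7) that by (simp add: LPDC_def)
    then show ?thesis
      unfolding good_def
      by (metis homotopy_eqv_contractibility homotopy_eqv_empty1 homotopy_eqv_empty2)
  qed
  have w: "w \<in> verts K" "\<And>x. x \<in> K \<Longrightarrow> w \<le> x" using assms(2) by (auto simp: minimum_vertex_def)
  have K'K: "K' \<subseteq> K" unfolding K' collapse_def by blast
  have thmK: "(\<forall>v\<in>verts K. nonempty_contractible_space (dipath_space K w v)) \<longleftrightarrow> (\<forall>v\<in>verts K - {w}. good K v)"
    unfolding good_def by (rule dipath_spaces_contractible_iff_past_links[OF cubes assms(2)])
  have thmK': "(\<forall>v\<in>verts K'. nonempty_contractible_space (dipath_space K' w v)) \<longleftrightarrow> (\<forall>v\<in>verts K' - {w}. good K' v)"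
    if "w \<in> K'"
  proof -
    have "minimum_vertex K' w" using that w K'K by (auto simp: minimum_vertex_def verts_def)
    then show ?thesis unfolding good_def
      using dipath_spaces_contractible_iff_past_links cube_union_collapse K' by blast
  qed
  show ?thesis
  proof (cases "cube t b = {s - ind c}")
    case True
    have "s - ind c \<in> int_points" using s(1) int_points_diff ind_in_int_points by blast
    then obtain v' where v': "v' \<in> verts K'" "s - ind c \<le> v'" "s - ind c \<noteq> v'"
      and nc: "geometric_realization (past_link_complex K' v') \<noteq> {} \<Longrightarrow>
        \<not> contractible (geometric_realization (past_link_complex K v'))"
      using removed_min_vertex True unfolding K' by metis
    \<comment> \<open>If one of the two links were good, both would be; but \<open>nc\<close>
      excludes a nonempty link in \<open>K'\<close> together with a contractible one in
      \<open>K\<close>.\<close>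
    have bad: "\<not> good K v'" "\<not> good K' v'" using nc same[OF v'(1)] unfolding good_def by blast+
    have "w \<le> s - ind c" using w(2) sub(2) min_corner by blast
    then have v'w: "v' \<noteq> w" using v'(2,3) by (metis antisym)
    have "v' \<in> verts K" using v'(1) K'K by (auto simp: verts_def)
    then have "\<not> (\<forall>v\<in>verts K. nonempty_contractible_space (dipath_space K w v))"
      using bad v'w unfolding thmK by blast
    moreover have "\<not> (\<forall>v\<in>verts K'. nonempty_contractible_space (dipath_space K' w v))"
    \<comment> \<open>The removed vertex may be \<open>w\<close> itself; then no dipath of
      \<open>K'\<close> starts in \<open>w\<close>, and the empty dipath space at \<open>v'\<close>
      already fails.\<close>
    proof (cases "w \<in> K'")
      case True
      then show ?thesis using bad v'w v'(1) unfolding thmK'[OF True] by blast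
    next
      case False
      then have "dipaths K' w v' = {}" by (force simp: dipaths_def)
      then show ?thesis using v'(1) unfolding nonempty_contractible_space_def topspace_dipath_space by blast
    qed
    ultimately show ?thesis by blast
  next
    case False
    \<comment> \<open>A removed vertex is \<open>\<tau>\<close>, and its link in \<open>K\<close> is
      good. It lies strictly above the lower corner of \<open>\<sigma>\<close>, hence differs from
      the minimum \<open>w\<close>.\<close>
    have removed: "good K v" "v \<noteq> w" if "v \<in> verts K" "v \<notin> verts K'" for v
    proof -
      have v: "cube t b = {v}" using that verts_collapse_iff K' by blast
      then have v2: "v \<noteq> s - ind c" using False by blast
      show "good K v"
        using removed_vertex_link[OF _ v v2] that unfolding good_def verts_def by blast
      have "w \<le> s - ind c" using w(2) sub(2) min_corner by blast
      moreover have "s - ind c \<le> v" using sub(1) v by auto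
      ultimately show "v \<noteq> w" using v2 by (metis antisym)
    qed
    then have "w \<in> K'" using w(1) by (auto simp: verts_def)
    moreover have "(\<forall>v\<in>verts K - {w}. good K v) \<longleftrightarrow> (\<forall>v\<in>verts K' - {w}. good K' v)"
      using removed same K'K unfolding verts_def by blast
    ultimately show ?thesis using thmK thmK' by blast
  qed
qed

end
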